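(* Let $a,b,c$ be positive integers with $b\ge a+c-1$. Then $$L^*_*(H_{\mathrm a}(a,b,c))=2^{-c-a}\,\frac{(b+2c-a+2)_a}{(a+b-c+2)_a}\prod_{j=1}^{a}\frac{(j-1)!\,(b+c-a+2j-1)!\,(b-a-c+2j+2)_j\,(b+2c-a+3j+2)_{a-j}}{(b+2j-1)!\,(c+a-j)!}.$$
   Context: Shifted factorial: $(\alpha)_k=\alpha(\alpha+1)\cdots(\alpha+k-1)$ for $k\ge1$, and $(\alpha)_0=1$. Triangular lattice: let $e=(1,0)$, $f=(1/2,\sqrt3/2)$, $g=f-e=(-1/2,\sqrt3/2)$, and consider the lattice $\mathbb Z e+\mathbb Z f$ with its tiling of the plane by unit equilateral triangles. A lozenge is the union of two unit triangles sharing an edge. A lozenge tiling of a region $R$ (a finite union of unit triangles) is a decomposition of $R$ into lozenges with disjoint interiors. $H(a,b,c)$ ($a,b,c$ positive integers) is the hexagon with vertices, in counterclockwise order, $0$ (southwestern corner), $be$ (southeastern corner), $be+af$ (eastern corner), $be+af+cg$ (northeastern corner), $af+cg$ (northwestern corner), $cg$ (western corner). Thus its horizontal sides have length $b$, the southeastern and northwestern sides have length $a$, and the northeastern and southwestern sides have length $c$. Maximal staircase at a corner $V$: let $p,q$ be the lengths of the two sides meeting at $V$, let $s,t$ be the unit vectors pointing from $V$ along these two sides (they form an angle of $120^\circ$), and let $m=\min(p,q)$. For $i,j\ge1$ let the cell $(i,j)$ be the lozenge with vertices $V+(i-1)s+(j-1)t$, $V+is+(j-1)t$, $V+is+jt$,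 $V+(i-1)s+jt$. The maximal staircase at $V$ is the union of all cells $(i,j)$ with $i,j\ge1$ and $i+j\le m$. The marked positions along the cut at $V$ are the $m$ cells $(i,j)$ with $i,j\ge1$ and $i+j=m+1$ (the lozenge positions fitting in the indentations of the zig-zag cut that removed the staircase). $H_{\mathrm a}(a,b,c)$ is the region obtained from $H(a,b,c)$ by removing the maximal staircases at the two top corners, i.e. at the northwestern corner (where sides of lengths $a$ and $b$ meet) and at the northeastern corner (where sides of lengths $b$ and $c$ meet). $L^*_*(H_{\mathrm a}(a,b,c))=\sum_T 2^{-k(T)}$, where $T$ ranges over all lozenge tilings of $H_{\mathrm a}(a,b,c)$ and $k(T)$ is the number of lozenges of $T$ that occupy marked positions along the cut at the northwestern corner or along the cut at the northeastern corner. *)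

theory Defs
  imports "HOL-Analysis.Analysis" "HOL-Library.Disjoint_Sets"
begin

text \<open>
  A point of the triangular lattice is given by its integer coordinates with respect to the
  lattice basis \<open>e, f\<close>: the pair \<open>(x, y)\<close> stands for \<open>x e + y f\<close>, and \<open>embed\<close> is its actual
  position in the plane. A region (a finite union of unit triangles) is represented by the set of
  the unit triangles it consists of, and a unit triangle by the set of its three vertices.
\<close>

type_synonym lattice_point = "int \<times> int"
type_synonym triangle = "lattice_point set"
type_synonym region = "triangle set"

definition vec_e :: lattice_point where "vec_e = (1, 0)"
definition vec_f :: lattice_point where "vec_f = (0, 1)"
definition vec_g :: lattice_point where "vec_g = vec_f - vec_e"

definition lscale :: "int \<Rightarrow> lattice_point \<Rightarrow> lattice_point"  (infixr "*\<^sub>L" 75) where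
  "k *\<^sub>L p = (k * fst p, k * snd p)"

definition embed :: "lattice_point \<Rightarrow> real \<times> real" where
  "embed p = of_int (fst p) *\<^sub>R (1, 0) + of_int (snd p) *\<^sub>R (1/2, sqrt 3 / 2)"

lemma embed_vecs:
  "embed vec_e = (1, 0)" "embed vec_f = (1/2, sqrt 3 / 2)" "embed vec_g = (-1/2, sqrt 3 / 2)"
  by (simp_all add: embed_def vec_e_def vec_f_def vec_g_def)

text \<open>The first alternative gives the upward pointing triangles, the second the downward
  pointing ones.\<close>

definition unit_triangle :: "triangle \<Rightarrow> bool" where
  "unit_triangle T \<longleftrightarrow>
     (\<exists>p. T = {p, p + vec_e, p + vec_f} \<or> T = {p, p + vec_f, p + vec_g})"

text \<open>Two unit triangles share an edge iff they have exactly two vertices in common.\<close>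

definition lozenge :: "region \<Rightarrow> bool" where
  "lozenge L \<longleftrightarrow>
     (\<exists>T U. unit_triangle T \<and> unit_triangle U \<and> card (T \<inter> U) = 2 \<and> L = {T, U})"

text \<open>Lozenges have disjoint interiors iff they have no unit triangle in common.\<close>

definition lozenge_tiling :: "region \<Rightarrow> region set \<Rightarrow> bool" where
  "lozenge_tiling R \<T> \<longleftrightarrow> partition_on R \<T> \<and> (\<forall>L\<in>\<T>. lozenge L)"

definition hexagon_vertices :: "nat \<Rightarrow> nat \<Rightarrow> nat \<Rightarrow> lattice_point set" where
  "hexagon_vertices a b c =
     {0,
      int b *\<^sub>L vec_e,
      int b *\<^sub>L vec_e + int a *\<^sub>L vec_f,
      int b *\<^sub>L vec_e + int a *\<^sub>L vec_f + int c *\<^sub>L vec_g,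
      int a *\<^sub>L vec_f + int c *\<^sub>L vec_g,
      int c *\<^sub>L vec_g}"

definition hexagon :: "nat \<Rightarrow> nat \<Rightarrow> nat \<Rightarrow> region" where
  "hexagon a b c =
     {T. unit_triangle T \<and>
         convex hull (embed ` T) \<subseteq> convex hull (embed ` hexagon_vertices a b c)}"

definition nw_corner :: "nat \<Rightarrow> nat \<Rightarrow> nat \<Rightarrow> lattice_point" where
  "nw_corner a b c = int a *\<^sub>L vec_f + int c *\<^sub>L vec_g"

definition ne_corner :: "nat \<Rightarrow> nat \<Rightarrow> nat \<Rightarrow> lattice_point" where
  "ne_corner a b c = int b *\<^sub>L vec_e + int a *\<^sub>L vec_f + int c *\<^sub>L vec_g"

text \<open>When \<open>s\<close> and \<open>t\<close> form an angle of 120 degrees, exactly two unit triangles have all their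
  vertices among the four points below, and their union is the lozenge with these vertices.\<close>

definition cell ::
  "lattice_point \<Rightarrow> lattice_point \<Rightarrow> lattice_point \<Rightarrow> int \<Rightarrow> int \<Rightarrow> region" where
  "cell V s t i j =
     {T. unit_triangle T \<and>
         T \<subseteq> {V + (i - 1) *\<^sub>L s + (j - 1) *\<^sub>L t,
               V + i *\<^sub>L s + (j - 1) *\<^sub>L t,
               V + i *\<^sub>L s + j *\<^sub>L t,
               V + (i - 1) *\<^sub>L s + j *\<^sub>L t}}"

definition staircase :: "lattice_point \<Rightarrow> lattice_point \<Rightarrow> lattice_point \<Rightarrow> nat \<Rightarrow> region" where
  "staircase V s t m = \<Union> {cell V s t i j | i j. 1 \<le> i \<and> 1 \<le> j \<and> i + j \<le> int m}"

definition marked_positions ::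
  "lattice_point \<Rightarrow> lattice_point \<Rightarrow> lattice_point \<Rightarrow> nat \<Rightarrow> region set" where
  "marked_positions V s t m = {cell V s t i j | i j. 1 \<le> i \<and> 1 \<le> j \<and> i + j = int m + 1}"

text \<open>
  The sides at the northwestern corner point in the directions \<open>e\<close> (length \<open>b\<close>) and \<open>-f\<close>
  (length \<open>a\<close>), those at the northeastern corner in the directions \<open>-e\<close> (length \<open>b\<close>) and \<open>-g\<close>
  (length \<open>c\<close>).
\<close>

definition Ha :: "nat \<Rightarrow> nat \<Rightarrow> nat \<Rightarrow> region" where
  "Ha a b c =
     hexagon a b c
       - (staircase (nw_corner a b c) vec_e (- vec_f) (min b a)
          \<union> staircase (ne_corner a b c) (- vec_e) (- vec_g) (min b c))"

definition Ha_marked :: "nat \<Rightarrow> nat \<Rightarrow> nat \<Rightarrow> region set" where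
  "Ha_marked a b c =
     marked_positions (nw_corner a b c) vec_e (- vec_f) (min b a)
       \<union> marked_positions (ne_corner a b c) (- vec_e) (- vec_g) (min b c)"

definition weighted_count_Ha :: "nat \<Rightarrow> nat \<Rightarrow> nat \<Rightarrow> real" where
  "weighted_count_Ha a b c =
     (\<Sum>\<T> | lozenge_tiling (Ha a b c) \<T>. (1/2) ^ card (\<T> \<inter> Ha_marked a b c))"

end

theory Submission
  imports Defs "Jordan_Normal_Form.Char_Poly"
begin

text \<open>
  Cut the plane along the lattice lines in direction \<open>f\<close>. On such a line \<open>x\<close>, call the height \<open>y\<close>
  of a unit edge of the region a particle if no lozenge of the tiling crosses that edge. From one
  line to the next a particle keeps its height (a lozenge with sides \<open>e\<close>, \<open>f\<close>) or loses one
  (a lozenge with sides \<open>f\<close>, \<open>g\<close>), and two particles never meet: these are the usual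
  non-intersecting paths of lozenges. The \<open>a\<close> particles start, one line after the other, in the
  notches of the northwestern cut and end at the heights \<open>0, \<dots>, a - 1\<close> of the southeastern side.

  The weighted number of tilings of the part of the region to the left of a line, with prescribed
  particles on that line, is a determinant: one row for every particle, one column for every
  source, each entry a weighted number of single walks. This is proved by induction on
  the line. Within one strip the triangles on its right are matched one at a time; each has two
  possible partners, the determinant is linear in the corresponding row, and the choices that make
  two particles collide yield equal rows (\<open>strip_transfer\<close>, \<open>left_sum_eq_row_det\<close>).

  The cuts enter only through the entries. At the northwestern cut a level first step has
  weight \<open>1/2\<close>. The northeastern cut is a wall: each of its \<open>c\<close> notches is either filled by a marked
  lozenge, with weight \<open>1/2\<close>, or touched by a path, with weight \<open>1\<close>. After a factor \<open>2 ^ (- c)\<close> has been taken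
  out, touching the wall has weight \<open>2\<close>, and then the reflection principle counts the walks below
  the wall as all walks to the endpoint plus all walks to its mirror image (\<open>step_row_eq\<close>).

  On the southeastern side every entry is therefore a sum over two mirrored endpoints. Multiplication by a
  unitriangular matrix of binomial coefficients lets the walks go on for \<open>2 m + 1\<close> further steps,
  until they end on the wall, where the entry is a single quotient of factorials
  (\<open>row_det_right_boundary\<close>). Up to a factor for each \<open>m\<close>, this is the matrix \<open>wall_entry\<close>. Deleting its first
  row or its first column only changes its two parameters, so the Desnanot--Jacobi identity
  gives a recursion for its determinants, and a product of factorials satisfies the same recursion
  (\<open>fdet_wall_entry\<close>).
\<close>

section \<open>Determinants and the Desnanot--Jacobi identity\<close>

text \<open>
  Matrices are given by their entry functions, so that deleting the first row or column is a shift
  of an argument and no carrier conditions arise.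
\<close>

definition fdet :: "nat \<Rightarrow> (nat \<Rightarrow> nat \<Rightarrow> 'a :: comm_ring_1) \<Rightarrow> 'a" where
  "fdet n f = Determinant.det (mat n n (\<lambda>(i, j). f i j))"

lemma fdet_cong:
  assumes "\<And>i j. i < n \<Longrightarrow> j < n \<Longrightarrow> f i j = g i j"
  shows "fdet n f = fdet n g"
  unfolding fdet_def by (intro arg_cong[where f = Determinant.det] eq_matI) (auto simp: assms)

lemma fdet_0 [simp]: "fdet 0 f = 1"
  unfolding fdet_def by (rule det_dim_zero) auto

lemma mat_delete_mat:
  "mat_delete (mat (Suc n) (Suc n) (\<lambda>(i, j). f i j)) k l =
     mat n n (\<lambda>(i, j). f (insert_index k i) (insert_index l j))"
  unfolding mat_delete_def by (intro eq_matI) (auto simp: insert_index_def)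

lemma fdet_expand_row:
  assumes "k < Suc n"
  shows "fdet (Suc n) f =
    (\<Sum>l<Suc n. f k l * ((-1) ^ (k + l) * fdet n (\<lambda>i j. f (insert_index k i) (insert_index l j))))"
proof -
  have "fdet (Suc n) f = (\<Sum>l<Suc n. mat (Suc n) (Suc n) (\<lambda>(i, j). f i j) $$ (k, l) *
          cofactor (mat (Suc n) (Suc n) (\<lambda>(i, j). f i j)) k l)"
    unfolding fdet_def by (rule laplace_expansion_row) (use assms in auto)
  then show ?thesis
    using assms by (simp add: cofactor_def mat_delete_mat fdet_def)
qed

lemma fdet_expand_col:
  assumes "l < Suc n"
  shows "fdet (Suc n) f =
    (\<Sum>k<Suc n. f k l * ((-1) ^ (k + l) * fdet n (\<lambda>i j. f (insert_index k i) (insert_index l j))))"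
proof -
  have "fdet (Suc n) f = (\<Sum>k<Suc n. mat (Suc n) (Suc n) (\<lambda>(i, j). f i j) $$ (k, l) *
          cofactor (mat (Suc n) (Suc n) (\<lambda>(i, j). f i j)) k l)"
    unfolding fdet_def by (rule laplace_expansion_column) (use assms in auto)
  then show ?thesis
    using assms by (simp add: cofactor_def mat_delete_mat fdet_def)
qed

lemma fdet_upper_triangular:
  assumes "\<And>i j. j < i \<Longrightarrow> i < n \<Longrightarrow> f i j = 0"
  shows "fdet n f = (\<Prod>i<n. f i i)"
proof -
  have "fdet n f = prod_list (diag_mat (mat n n (\<lambda>(i, j). f i j)))"
    unfolding fdet_def by (rule det_upper_triangular[where n = n]) (use assms in auto)
  also have "\<dots> = (\<Prod>i<n. f i i)"
    by (simp add: diag_mat_def prod.list_conv_set_nth atLeast0LessThan)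
  finally show ?thesis .
qed

lemma fdet_mult:
  "fdet n f * fdet n g = fdet n (\<lambda>i j. \<Sum>k<n. f i k * g k j)"
proof -
  have "fdet n f * fdet n g = Determinant.det (mat n n (\<lambda>(i, j). f i j) * mat n n (\<lambda>(i, j). g i j))"
    unfolding fdet_def by (rule Determinant.det_mult[symmetric, where n = n]) auto
  also have "mat n n (\<lambda>(i, j). f i j) * mat n n (\<lambda>(i, j). g i j) = mat n n (\<lambda>(i, j). \<Sum>k<n. f i k * g k j)"
    by (intro eq_matI) (auto simp: scalar_prod_def atLeast0LessThan)
  finally show ?thesis by (simp add: fdet_def)
qed

lemma fdet_hom:
  assumes "comm_ring_hom h"
  shows "h (fdet n f) = fdet n (\<lambda>i j. h (f i j))"
proof -
  interpret comm_ring_hom h by fact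
  show ?thesis unfolding fdet_def hom_det[symmetric]
    by (intro arg_cong[where f = Determinant.det] eq_matI) auto
qed

definition fcofactor :: "nat \<Rightarrow> (nat \<Rightarrow> nat \<Rightarrow> 'a :: comm_ring_1) \<Rightarrow> nat \<Rightarrow> nat \<Rightarrow> 'a" where
  "fcofactor n f i j = (-1) ^ (i + j) * fdet n (\<lambda>i' j'. f (insert_index i i') (insert_index j j'))"

text \<open>
  The entries of the product of \<open>f\<close> and its adjugate.
\<close>

lemma sum_fcofactor:
  assumes "i < Suc n" "k < Suc n"
  shows "(\<Sum>j<Suc n. f i j * fcofactor n f k j) = (if i = k then fdet (Suc n) f else 0)"
proof -
  let ?A = "mat (Suc n) (Suc n) (\<lambda>(i, j). f i j)"
  have A: "?A \<in> carrier_mat (Suc n) (Suc n)" by simp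
  have "(?A * adj_mat ?A) $$ (i, k) = (\<Sum>j<Suc n. f i j * fcofactor n f k j)"
    using assms adj_mat(1)[OF A]
    by (auto simp: scalar_prod_def adj_mat_def cofactor_def mat_delete_mat fcofactor_def fdet_def
        atLeast0LessThan intro!: sum.cong)
  then show ?thesis using assms unfolding adj_mat(2)[OF A] by (auto simp: fdet_def)
qed

lemma insert_index_last: "i < n \<Longrightarrow> insert_index n i = i" by (simp add: insert_index_def)

lemma insert_index_0: "insert_index 0 i = Suc i" by (simp add: insert_index_def)

lemma sum_two_terms:
  fixes u :: "nat \<Rightarrow> 'a :: comm_monoid_add"
  assumes "\<And>i. 0 < i \<Longrightarrow> i < Suc n \<Longrightarrow> u i = 0"
  shows "(\<Sum>i<Suc (Suc n). u i) = u 0 + u (Suc n)"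
proof -
  have "(\<Sum>i<Suc (Suc n). u i) = (\<Sum>i<Suc n. u i) + u (Suc n)" by simp
  also have "(\<Sum>i<Suc n. u i) = u 0" unfolding sum.lessThan_Suc_shift using assms by simp
  finally show ?thesis .
qed

text \<open>
  Multiply the matrix \<open>f\<close> by the matrix \<open>B\<close> obtained from the identity by replacing its first and
  last columns by those of the adjugate of \<open>f\<close>. The first and last columns of the product are
  \<open>det f\<close> times unit vectors and the others are those of \<open>f\<close>, so the product has determinant
  \<open>(det f)\<^sup>2\<close> times that of the interior of \<open>f\<close>, whereas \<open>det B\<close> is a \<open>2 \<times> 2\<close> determinant of
  cofactors. Cancelling one factor \<open>det f\<close> gives the identity.
\<close>

lemma desnanot_jacobi_regular:
  fixes f :: "nat \<Rightarrow> nat \<Rightarrow> 'a :: idom"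
  assumes "fdet (Suc (Suc n)) f \<noteq> 0"
  shows "fdet (Suc (Suc n)) f * fdet n (\<lambda>i j. f (Suc i) (Suc j)) =
    fdet (Suc n) f * fdet (Suc n) (\<lambda>i j. f (Suc i) (Suc j))
    - fdet (Suc n) (\<lambda>i j. f (Suc i) j) * fdet (Suc n) (\<lambda>i j. f i (Suc j))"
proof -
  let ?L = "Suc n"
  define B where "B = (\<lambda>i j. if j = 0 then fcofactor ?L f 0 i else if j = ?L then fcofactor ?L f ?L i
     else if i = j then 1 else 0)"
  have detB: "fdet (Suc ?L) B = B 0 0 * B ?L ?L - B 0 ?L * B ?L 0"
  proof -
    have 1: "fdet ?L (\<lambda>i j. B (Suc i) (Suc j)) = B ?L ?L"
    proof -
      have "fdet ?L (\<lambda>i j. B (Suc i) (Suc j)) = (\<Prod>i<?L. B (Suc i) (Suc i))"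
        by (rule fdet_upper_triangular) (auto simp: B_def)
      also have "\<dots> = B ?L ?L" by (simp add: B_def)
      finally show ?thesis .
    qed
    \<comment> \<open>The last row of this minor has a single nonzero entry, in its first column.\<close>
    have 2: "fdet ?L (\<lambda>i j. B (Suc i) (insert_index ?L j)) = (-1) ^ n * B ?L 0"
    proof -
      have "fdet ?L (\<lambda>i j. B (Suc i) (insert_index ?L j)) =
          (\<Sum>l<?L. B (Suc n) (insert_index ?L l) * ((-1) ^ (n + l) *
            fdet n (\<lambda>i j. B (Suc (insert_index n i)) (insert_index ?L (insert_index l j)))))"
        by (rule fdet_expand_row) simp
      also have "\<dots> = B ?L 0 * ((-1) ^ n * fdet n (\<lambda>i j. B (Suc (insert_index n i)) (insert_index ?L (insert_index 0 j))))"
        unfolding sum.lessThan_Suc_shift by (simp add: B_def insert_index_def)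
      also have "fdet n (\<lambda>i j. B (Suc (insert_index n i)) (insert_index ?L (insert_index 0 j)))
          = fdet n (\<lambda>i j. if i = j then 1 else 0)"
        by (rule fdet_cong) (auto simp: B_def insert_index_def)
      also have "\<dots> = (\<Prod>i<n. if i = i then 1 else 0)"
        by (rule fdet_upper_triangular) auto
      finally show ?thesis by simp
    qed
    have "fdet (Suc ?L) B = (\<Sum>l<Suc ?L. B 0 l * ((-1) ^ (0 + l) *
            fdet ?L (\<lambda>i j. B (insert_index 0 i) (insert_index l j))))"
      by (rule fdet_expand_row) simp
    also have "\<dots> = B 0 0 * fdet ?L (\<lambda>i j. B (Suc i) (Suc j))
        + B 0 ?L * ((-1) ^ ?L * fdet ?L (\<lambda>i j. B (Suc i) (insert_index ?L j)))"
      by (subst sum_two_terms) (auto simp: B_def insert_index_0)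
    finally show ?thesis unfolding 1 2 by (simp add: power_add[symmetric] mult.assoc[symmetric])
  qed
  define C where "C = (\<lambda>i j. \<Sum>k<Suc ?L. f i k * B k j)"
  let ?D = "fdet (Suc ?L) f"
  have C0: "C i 0 = (if i = 0 then ?D else 0)" if "i < Suc ?L" for i
    using sum_fcofactor[of i ?L 0 f] that by (simp add: C_def B_def)
  have CL: "C i ?L = (if i = ?L then ?D else 0)" if "i < Suc ?L" for i
    using sum_fcofactor[of i ?L ?L f] that by (simp add: C_def B_def)
  have Cm: "C i (Suc j) = f i (Suc j)" if "j < n" for i j
  proof -
    have "C i (Suc j) = (\<Sum>k<Suc ?L. if k = Suc j then f i k else 0)"
      unfolding C_def by (rule sum.cong) (use that in \<open>auto simp: B_def\<close>)
    then show ?thesis using that by simp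
  qed
  have "fdet (Suc ?L) C = (\<Sum>k<Suc ?L. C k 0 * ((-1) ^ (k + 0) *
            fdet ?L (\<lambda>i j. C (insert_index k i) (insert_index 0 j))))"
    by (rule fdet_expand_col) simp
  also have "\<dots> = (\<Sum>k<Suc ?L. if k = 0 then ?D * fdet ?L (\<lambda>i j. C (Suc i) (Suc j)) else 0)"
    by (rule sum.cong) (auto simp: C0 insert_index_0)
  also have "\<dots> = ?D * fdet ?L (\<lambda>i j. C (Suc i) (Suc j))" by simp
  also have "fdet ?L (\<lambda>i j. C (Suc i) (Suc j)) = (\<Sum>k<Suc n. C (Suc k) (Suc n) * ((-1) ^ (k + n) *
            fdet n (\<lambda>i j. C (Suc (insert_index k i)) (Suc (insert_index n j)))))"
    by (rule fdet_expand_col) simp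
  also have "\<dots> = (\<Sum>k<Suc n. if k = n then ?D *
            fdet n (\<lambda>i j. C (Suc (insert_index n i)) (Suc (insert_index n j))) else 0)"
    by (rule sum.cong) (auto simp: CL power_add[symmetric])
  also have "\<dots> = ?D * fdet n (\<lambda>i j. f (Suc i) (Suc j))"
    by (simp, intro disjI2 fdet_cong) (auto simp: Cm insert_index_last)
  finally have "?D * fdet (Suc ?L) B = ?D * (?D * fdet n (\<lambda>i j. f (Suc i) (Suc j)))"
    unfolding fdet_mult C_def .
  then have "?D * fdet n (\<lambda>i j. f (Suc i) (Suc j)) = B 0 0 * B ?L ?L - B 0 ?L * B ?L 0"
    using assms detB by simp
  moreover have "B 0 0 = fdet ?L (\<lambda>i j. f (Suc i) (Suc j))"
    by (simp add: B_def fcofactor_def insert_index_0)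
  moreover have "B ?L ?L = fdet ?L f"
    by (auto simp: B_def fcofactor_def insert_index_last power_add[symmetric] intro!: fdet_cong)
  moreover have "B 0 ?L = (-1) ^ ?L * fdet ?L (\<lambda>i j. f i (Suc j))"
    by (auto simp: B_def fcofactor_def insert_index_last insert_index_0 intro!: fdet_cong)
  moreover have "B ?L 0 = (-1) ^ ?L * fdet ?L (\<lambda>i j. f (Suc i) j)"
    by (auto simp: B_def fcofactor_def insert_index_last insert_index_0 intro!: fdet_cong)
  moreover have "((-1) ^ ?L * x) * ((-1) ^ ?L * y) = y * x" for x y :: 'a
    by (cases "even ?L") (auto simp del: power_Suc)
  ultimately show ?thesis by simp
qed

text \<open>
  A singular matrix is deformed to \<open>f + X \<cdot> 1\<close> over the polynomial ring. The determinant of this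
  matrix is the characteristic polynomial of \<open>- f\<close>, which is monic and hence nonzero; the
  identity for the deformed matrix is then evaluated at \<open>X = 0\<close>.
\<close>

lemma desnanot_jacobi:
  fixes f :: "nat \<Rightarrow> nat \<Rightarrow> 'a :: idom"
  shows "fdet (Suc (Suc n)) f * fdet n (\<lambda>i j. f (Suc i) (Suc j)) =
    fdet (Suc n) f * fdet (Suc n) (\<lambda>i j. f (Suc i) (Suc j))
    - fdet (Suc n) (\<lambda>i j. f (Suc i) j) * fdet (Suc n) (\<lambda>i j. f i (Suc j))"
proof -
  define g :: "nat \<Rightarrow> nat \<Rightarrow> 'a poly" where "g = (\<lambda>i j. [:f i j, if i = j then 1 else 0:])"
  have ev: "poly (fdet m h) 0 = fdet m (\<lambda>i j. poly (h i j) 0)" for m and h :: "nat \<Rightarrow> nat \<Rightarrow> 'a poly"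
    by (rule fdet_hom) (standard, auto)
  let ?A = "mat (Suc (Suc n)) (Suc (Suc n)) (\<lambda>(i, j). - f i j)"
  have "char_poly ?A = fdet (Suc (Suc n)) g"
    unfolding char_poly_def fdet_def char_poly_matrix_def
    by (intro arg_cong[where f = Determinant.det] eq_matI) (auto simp: g_def)
  moreover have "monic (char_poly ?A)" by (use degree_monic_char_poly[of ?A "Suc (Suc n)"] in simp)
  ultimately have "fdet (Suc (Suc n)) g \<noteq> 0" by auto
  from arg_cong[OF desnanot_jacobi_regular[OF this], of "\<lambda>p. poly p 0"]
  show ?thesis by (simp add: ev) (simp add: g_def)
qed

lemma fdet_transpose: "fdet n (\<lambda>i j. f j i) = fdet n f"
proof -
  have "transpose_mat (mat n n (\<lambda>(i, j). f i j)) = mat n n (\<lambda>(i, j). f j i)"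
    by (rule eq_matI) auto
  then show ?thesis using Determinant.det_transpose[of "mat n n (\<lambda>(i, j). f i j)" n] by (simp add: fdet_def)
qed

lemma fdet_lower_triangular:
  assumes "\<And>i j. i < j \<Longrightarrow> j < n \<Longrightarrow> f i j = 0"
  shows "fdet n f = (\<Prod>i<n. f i i)"
  by (subst fdet_transpose[symmetric], rule fdet_upper_triangular) (use assms in auto)

lemma fdet_scale_rows: "fdet n (\<lambda>i j. v i * f i j) = (\<Prod>i<n. v i) * fdet n f"
proof -
  have "fdet n (\<lambda>i j. if i = j then v i else 0) * fdet n f = fdet n (\<lambda>i j. v i * f i j)"
    unfolding fdet_mult by (rule fdet_cong) (simp add: if_distrib[of "\<lambda>x. x * _"] cong: if_cong)
  moreover have "fdet n (\<lambda>i j. if i = j then v i else 0) = (\<Prod>i<n. v i)"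
    by (subst fdet_upper_triangular) auto
  ultimately show ?thesis by simp
qed

text \<open>
  The determinant as a function of the list of its rows, used to add the rows one at a time.
\<close>

definition row_det :: "(nat \<Rightarrow> real) list \<Rightarrow> real" where
  "row_det vs = fdet (length vs) (\<lambda>i. vs ! i)"

lemma row_det_expand:
  "row_det (us @ f # vs) = (\<Sum>l<Suc (length us + length vs). f l * ((-1) ^ (length us + l) *
     fdet (length us + length vs) (\<lambda>i j. ((us @ vs) ! i) (insert_index l j))))"
proof -
  let ?n = "length us + length vs"
  have "row_det (us @ f # vs) = (\<Sum>l<Suc ?n. ((us @ f # vs) ! length us) l * ((-1) ^ (length us + l) *
     fdet ?n (\<lambda>i j. ((us @ f # vs) ! insert_index (length us) i) (insert_index l j))))"
    unfolding row_det_def using fdet_expand_row[of "length us" ?n "\<lambda>i. (us @ f # vs) ! i"] by simp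
  moreover have "(us @ f # vs) ! insert_index (length us) i = (us @ vs) ! i" for i
    by (simp add: insert_index_def nth_append Suc_diff_le)
  ultimately show ?thesis by simp
qed

lemma row_det_linear:
  "row_det (us @ (\<lambda>i. r * f i + s * g i) # vs) = r * row_det (us @ f # vs) + s * row_det (us @ g # vs)"
  unfolding row_det_expand by (simp add: sum.distrib sum_distrib_left algebra_simps del: sum.lessThan_Suc)

lemma row_det_eq_0_if_repeated:
  assumes "f \<in> set us"
  shows "row_det (us @ f # vs) = 0"
proof -
  let ?n = "Suc (length us + length vs)" and ?r = "us @ f # vs"
  obtain k where k: "k < length us" "us ! k = f" using assms by (auto simp: in_set_conv_nth)
  have "Determinant.det (mat ?n ?n (\<lambda>(i, j). (?r ! i) j)) = 0"
    by (rule det_identical_rows[where n = ?n and i = k and j = "length us"])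
      (use k in \<open>auto simp: nth_append intro!: eq_vecI\<close>)
  then show ?thesis by (simp add: row_det_def fdet_def)
qed

lemma row_det_eq_0_if_zero_column:
  assumes "k < length vs" "\<And>v. v \<in> set vs \<Longrightarrow> v k = 0"
  shows "row_det vs = 0"
proof -
  obtain n where n: "length vs = Suc n" using assms(1) by (cases "length vs") auto
  have "(vs ! j) k = 0" if "j < Suc n" for j using assms(2) n that by simp
  then show ?thesis unfolding row_det_def n
    by (subst fdet_expand_col[of k]) (use assms(1) n in \<open>auto intro!: sum.neutral simp del: sum.lessThan_Suc\<close>)
qed

lemma row_det_cong:
  assumes "list_all2 (\<lambda>u v. \<forall>i<n. u i = v i) us vs" "length vs = n"
  shows "row_det us = row_det vs"
  unfolding row_det_def list_all2_lengthD[OF assms(1)]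
  by (rule fdet_cong) (use assms in \<open>auto simp: list_all2_conv_all_nth\<close>)

section \<open>A determinant of factorial quotients\<close>

text \<open>
  Factorials in arithmetic progression; the two ways of splitting off a factor, at the front and
  at the back, turn quotients of such products into rational functions.
\<close>

definition fact_prod :: "nat \<Rightarrow> nat \<Rightarrow> nat \<Rightarrow> real" where
  "fact_prod k n u = (\<Prod>j<n. fact (u + k * j))"

lemma fact_prod_0 [simp]: "fact_prod k 0 u = 1" by (simp add: fact_prod_def)

lemma fact_prod_pos: "fact_prod k n u > 0" by (simp add: fact_prod_def prod_pos)

lemma fact_prod_front: "fact_prod k (Suc n) u = fact u * fact_prod k n (u + k)"
  by (simp add: fact_prod_def prod.lessThan_Suc_shift algebra_simps del: prod.lessThan_Suc)

lemma fact_prod_back: "fact_prod k (Suc n) u = fact_prod k n u * fact (u + k * n)"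
  by (simp add: fact_prod_def)

text \<open>
  Up to a factor depending on \<open>m\<close> only, the weighted number of walks from the source \<open>i\<close> that end
  on the wall after \<open>2 m + 1\<close> additional steps (see \<open>half_walks_wall_entry\<close>). The entry vanishes
  when the walk would have to go up.
\<close>

definition wall_entry :: "nat \<Rightarrow> nat \<Rightarrow> nat \<Rightarrow> nat \<Rightarrow> real" where
  "wall_entry B c i m = (if i \<le> c + m then fact (B + c + i + 2 * m + 1) / (fact (c + m - i) * fact (B + 2 * i + m + 2)) else 0)"

definition wall_product :: "nat \<Rightarrow> nat \<Rightarrow> nat \<Rightarrow> real" where
  "wall_product n B c =
     (fact_prod 1 n 0 * fact_prod 2 n (B + c + 1) * fact_prod 3 n (B + 1 - c) * fact_prod 2 n (B + 2 * c + n + 1)) /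
     (fact_prod 3 n (B + 2 * c + 2) * fact_prod 2 n (B + 1 - c) * fact_prod 1 n c * fact_prod 2 n (B + n + 1))"

lemma quot_mult:
  fixes a b c d :: real
  shows "(a * b * c * d) / (p * q * r * s) * ((a' * b' * c' * d') / (p' * q' * r' * s')) =
   ((a * a') * (b * b') * (c * c') * (d * d')) / ((p * p') * (q * q') * (r * r') * (s * s'))"
  by (simp add: mult_ac)

lemma wall_product_neq_0: "wall_product n B c \<noteq> 0"
  unfolding wall_product_def using fact_prod_pos[THEN less_imp_neq, THEN not_sym] by simp

text \<open>
  The next seven identities compare, for one family of factorials, the two products of
  \<open>(n + 1)\<close>-fold products in the Desnanot--Jacobi identity with the product of an \<open>(n + 2)\<close>-fold and an
  \<open>n\<close>-fold one. In each case all factorials but one or two cancel.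
\<close>

lemma fact_prod_step_low: "fact_prod 2 (n + 1) v * fact_prod 2 (n + 1) (v + 3) = fact_prod 2 (n + 2) (v + 1) * fact_prod 2 n (v + 2) / real (v + 1)"
proof -
  have "fact_prod 2 (n + 2) (v + 1) = fact (v + 1) * fact_prod 2 (n + 1) (v + 3)"
    using fact_prod_front[of 2 "n+1" "v+1"] by (simp add: eval_nat_numeral)
  moreover have "fact_prod 2 (n + 1) v = fact v * fact_prod 2 n (v + 2)" using fact_prod_front[of 2 n v] by simp
  ultimately show ?thesis by (simp add: field_simps)
qed

lemma fact_prod_step_high: "fact_prod 2 (n + 1) v * fact_prod 2 (n + 1) (v + 3) = real (v + 2 * n + 3) * (fact_prod 2 (n + 2) v * fact_prod 2 n (v + 3))"
  using fact_prod_back[of 2 "n+1" v] fact_prod_back[of 2 n "v+3"] fact_Suc[of "v + 2 * n + 2", where 'a = real]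
  by (simp add: eval_nat_numeral algebra_simps)

lemma fact_prod_step_mid: "fact_prod 2 (n + 1) (v + 1) * fact_prod 2 (n + 1) (v + 2) = real (v + 1) * (fact_prod 2 (n + 2) v * fact_prod 2 n (v + 3))"
  using fact_prod_front[of 2 "n+1" v] fact_prod_front[of 2 n "v+1"] by (simp add: eval_nat_numeral algebra_simps)

lemma fact_prod_step_last: "fact_prod 2 (n + 1) (v + 1) * fact_prod 2 (n + 1) v = fact_prod 2 (n + 2) v * fact_prod 2 n (v + 1) / real (v + 2 * n + 2)"
proof -
  have "fact_prod 2 (n + 2) v = fact_prod 2 (n + 1) v * (real (v + 2 * n + 2) * fact (v + 2 * n + 1))"
    using fact_prod_back[of 2 "n+1" v] by (simp add: eval_nat_numeral algebra_simps)
  moreover have "fact_prod 2 (n + 1) (v + 1) = fact_prod 2 n (v + 1) * fact (v + 2 * n + 1)"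
    using fact_prod_back[of 2 n "v+1"] by simp
  moreover have "real (v + 2 * n + 2) \<noteq> 0" by linarith
  ultimately show ?thesis by simp
qed

lemma fact_prod_step_3: "fact_prod 3 (n + 1) v * fact_prod 3 (n + 1) (v + 3) = fact_prod 3 (n + 2) v * fact_prod 3 n (v + 3)"
  using fact_prod_back[of 3 "n+1" v] fact_prod_back[of 3 n "v+3"] by (simp add: algebra_simps)

lemma fact_prod_step_1: "fact_prod 1 (n + 1) v * fact_prod 1 (n + 1) v = fact_prod 1 (n + 2) v * fact_prod 1 n v / real (v + n + 1)"
proof -
  have "fact_prod 1 (n + 2) v = fact_prod 1 (n + 1) v * (real (v + n + 1) * fact (v + n))"
    using fact_prod_back[of 1 "n+1" v] by simp
  moreover have "fact_prod 1 (n + 1) v = fact_prod 1 n v * fact (v + n)"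
    using fact_prod_back[of 1 n v] by simp
  moreover have "real (v + n + 1) \<noteq> 0" by linarith
  ultimately show ?thesis by simp
qed

lemma fact_prod_step_1_shift: "fact_prod 1 (n + 1) v * fact_prod 1 (n + 1) (v + 2) = fact_prod 1 (n + 2) (v + 1) * fact_prod 1 n (v + 1) / real (v + 1)"
proof -
  have "fact_prod 1 (n + 2) (v + 1) = fact (v + 1) * fact_prod 1 (n + 1) (v + 2)"
    using fact_prod_front[of 1 "n+1" "v+1"] by simp
  moreover have "fact_prod 1 (n + 1) v = fact v * fact_prod 1 n (v + 1)"
    using fact_prod_front[of 1 n v] by simp
  ultimately show ?thesis by (simp add: field_simps)
qed

text \<open>
  Collects the rational factors produced by the eight families of factorials in \<open>wall_product\<close>.
\<close>

lemma quot_collect: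
  fixes w :: real
  shows "(p1 / a1 * (k * p2) * p3 * (p4 / w)) / (q1 * (e * q2) * (q3 / c) * (q4 / v)) =
    (k * c * v) / (a1 * e * w) * ((p1 * p2 * p3 * p4) / (q1 * q2 * q3 * q4))"
  by (simp add: divide_inverse mult_ac)

text \<open>
  The quotient of the product formulas for the two minors on the diagonal by those for the whole
  matrix and its interior; \<open>wall_product_antidiagonal\<close> is its counterpart for the other two minors.
\<close>

lemma wall_product_diagonal:
  assumes "c \<le> B + 1"
  shows "wall_product (n + 1) B c * wall_product (n + 1) (B + 3) c =
    (real (B + c + 1 + 2 * n + 3) * real (c + n + 1) * real (B + n + 2 + 1)) /
    (real (0 + n + 1) * real (B + 1 - c + 2 * n + 3) * real (B + 2 * c + n + 2 + 1)) *
    (wall_product (n + 2) B c * wall_product n (B + 3) c)"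
proof -
  define e where "e = B + 1 - c"
  have B: "B + 3 + 1 - c = e + 3" "B + 1 - c = e" using assms by (auto simp: e_def)
  have sp: "B + 3 + c + 1 = (B + c + 1) + 3" "B + 3 + 2 * c + (n + 1) + 1 = (B + 2 * c + n + 2) + 3"
    "B + 2 * c + (n + 1) + 1 = B + 2 * c + n + 2" "B + 3 + 2 * c + 2 = (B + 2 * c + 2) + 3"
    "B + 3 + (n + 1) + 1 = (B + n + 2) + 3" "B + (n + 1) + 1 = B + n + 2"
    "B + 2 * c + (n + 2) + 1 = B + 2 * c + n + 2 + 1" "B + 3 + 2 * c + n + 1 = (B + 2 * c + n + 2) + 2"
    "B + (n + 2) + 1 = B + n + 2 + 1" "B + 3 + n + 1 = B + n + 2 + 2" by auto
  show ?thesis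
    unfolding wall_product_def B quot_mult sp fact_prod_step_low[of n "B + n + 2"] fact_prod_step_low[of n "B + 2 * c + n + 2"]
      fact_prod_step_high[of n e] fact_prod_step_high[of n "B + c + 1"] fact_prod_step_3 fact_prod_step_1 quot_collect ..
qed

lemma wall_product_antidiagonal:
  assumes "c \<le> B"
  shows "wall_product (n + 1) (B + 2) c * wall_product (n + 1) (B + 1) (c + 2) =
    (real (B + c + 2 + 1) * real (c + 1) * real (B + n + 3 + 2 * n + 2)) /
    (real (0 + n + 1) * real (B - c + 2 * n + 3) * real (B + 2 * c + n + 4 + 1)) *
    (wall_product (n + 2) B (c + 1) * wall_product n (B + 3) (c + 1))"
proof -
  define e where "e = B - c"
  have B: "B + 2 + 1 - c = e + 3" "B + 1 + 1 - (c + 2) = e" "B + 1 - (c + 1) = e" "B + 3 + 1 - (c + 1) = e + 3"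
     "B - c = e" using assms by (auto simp: e_def)
  have sp: "B + 2 + c + 1 = (B + c + 2) + 1" "B + 1 + (c + 2) + 1 = (B + c + 2) + 2"
    "B + (c + 1) + 1 = B + c + 2" "B + 3 + (c + 1) + 1 = (B + c + 2) + 3"
    "B + 2 + 2 * c + (n + 1) + 1 = B + 2 * c + n + 4"
    "B + 1 + 2 * (c + 2) + (n + 1) + 1 = (B + 2 * c + n + 4) + 3"
    "B + 2 * (c + 1) + (n + 2) + 1 = B + 2 * c + n + 4 + 1"
    "B + 3 + 2 * (c + 1) + n + 1 = (B + 2 * c + n + 4) + 2"
    "B + 2 + 2 * c + 2 = B + 2 * c + 4" "B + 1 + 2 * (c + 2) + 2 = (B + 2 * c + 4) + 3"
    "B + 2 * (c + 1) + 2 = B + 2 * c + 4" "B + 3 + 2 * (c + 1) + 2 = (B + 2 * c + 4) + 3"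
    "B + 2 + (n + 1) + 1 = (B + n + 3) + 1" "B + 1 + (n + 1) + 1 = B + n + 3"
    "B + (n + 2) + 1 = B + n + 3" "B + 3 + n + 1 = B + n + 3 + 1" by auto
  have e3: "fact_prod k (n + 1) (e + 3) * fact_prod k (n + 1) e = fact_prod k (n + 1) e * fact_prod k (n + 1) (e + 3)" for k by simp
  show ?thesis
    unfolding wall_product_def B quot_mult sp e3 fact_prod_step_low[of n "B + 2 * c + n + 4"] fact_prod_step_1_shift
      fact_prod_step_high[of n e] fact_prod_step_3 fact_prod_step_1 fact_prod_step_mid fact_prod_step_last quot_collect ..
qed

text \<open>
  The two quotients are rational functions with a common denominator \<open>q\<close>, whose numerators differ
  by exactly \<open>q\<close>.
\<close>

lemma wall_product_condensation:
  assumes "c \<le> B"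
  shows "wall_product (n + 2) B (c + 1) * wall_product n (B + 3) (c + 1) =
     wall_product (n + 1) B (c + 1) * wall_product (n + 1) (B + 3) (c + 1) - wall_product (n + 1) (B + 2) c * wall_product (n + 1) (B + 1) (c + 2)"
proof -
  obtain d where B: "B = c + d" using assms by (metis le_iff_add)
  have 1: "B + 1 - (c + 1) + 2 * n + 3 = d + 2 * n + 3" "B - c + 2 * n + 3 = d + 2 * n + 3"
    "B + 2 * (c + 1) + n + 2 + 1 = B + 2 * c + n + 4 + 1" by (auto simp: B)
  \<comment> \<open>\<open>q\<close> is the common denominator of the two quotients, \<open>u\<close> and \<open>v\<close> are their numerators.\<close>
  define q where "q = real (0 + n + 1) * real (d + 2 * n + 3) * real (B + 2 * c + n + 4 + 1)"
  define u where "u = real (B + (c + 1) + 1 + 2 * n + 3) * real (c + 1 + n + 1) * real (B + n + 2 + 1)"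
  define v where "v = real (B + c + 2 + 1) * real (c + 1) * real (B + n + 3 + 2 * n + 2)"
  have q: "q \<noteq> 0" unfolding q_def mult_eq_0_iff of_nat_eq_0_iff by simp
  have "u - v = q" unfolding u_def v_def q_def B by (simp add: algebra_simps)
  then have uv: "u / q = v / q + 1"
    using q by (simp add: field_simps)
  show ?thesis
    using wall_product_diagonal[of "c + 1" B n] wall_product_antidiagonal[OF assms, of n] assms
    unfolding 1 q_def[symmetric] u_def[symmetric] v_def[symmetric] uv by (simp add: distrib_right)
qed

text \<open>
  For \<open>c = 0\<close> the term in which \<open>c\<close> decreases disappears from the recursion.
\<close>

lemma wall_product_condensation_0:
  shows "wall_product (n + 2) B 0 * wall_product n (B + 3) 0 = wall_product (n + 1) B 0 * wall_product (n + 1) (B + 3) 0"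
  using wall_product_diagonal[of 0 B n] by (simp add: add_ac)

lemma wall_entry_shift:
  "wall_entry B c (Suc i) (Suc m) = wall_entry (B + 3) c i m"
  "wall_entry B (c + 1) (Suc i) m = wall_entry (B + 2) c i m"
  "wall_entry B c i (Suc m) = wall_entry (B + 1) (c + 1) i m"
  by (simp_all add: wall_entry_def eval_nat_numeral)

text \<open>
  Induction on the size by Desnanot--Jacobi. All minors belong to the same family by
  \<open>wall_entry_shift\<close>, and the assumption \<open>c \<le> B + 1\<close> is preserved by the four shifts. The induction
  can be carried out because the product formula for the interior minor is nonzero.
\<close>

lemma fdet_wall_entry:
  "c \<le> B + 1 \<Longrightarrow> fdet n (wall_entry B c) = wall_product n B c"
proof (induction n arbitrary: B c rule: induct_nat_012)
  case 0
  show ?case by (simp add: wall_product_def)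
next
  case 1
  have "fdet (Suc 0) (wall_entry B c) = wall_entry B c 0 0" by (subst fdet_expand_row[of 0]) auto
  also have "\<dots> = wall_product (Suc 0) B c" by (simp add: wall_entry_def wall_product_def fact_prod_front)
  finally show ?case .
next
  case (ge2 n)
  have dj: "fdet (n + 2) (wall_entry B c) * fdet n (wall_entry (B + 3) c) =
    fdet (n + 1) (wall_entry B c) * fdet (n + 1) (wall_entry (B + 3) c)
    - fdet (n + 1) (\<lambda>i. wall_entry B c (Suc i)) * fdet (n + 1) (wall_entry (B + 1) (c + 1))"
    using desnanot_jacobi[of n "wall_entry B c"] unfolding wall_entry_shift(1) unfolding wall_entry_shift(3) by simp
  have IH: "fdet n (wall_entry (B + 3) c) = wall_product n (B + 3) c" "fdet (n + 1) (wall_entry (B + 3) c) = wall_product (n + 1) (B + 3) c"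
    "fdet (n + 1) (wall_entry B c) = wall_product (n + 1) B c" "fdet (n + 1) (wall_entry (B + 1) (c + 1)) = wall_product (n + 1) (B + 1) (c + 1)"
    using ge2.IH(1)[of c "B + 3"] ge2.IH(2)[of c "B + 3"] ge2.IH(2)[of c B] ge2.IH(2)[of "c + 1" "B + 1"] ge2.prems by simp_all
  have "wall_product (n + 2) B c * wall_product n (B + 3) c =
    wall_product (n + 1) B c * wall_product (n + 1) (B + 3) c
    - fdet (n + 1) (\<lambda>i. wall_entry B c (Suc i)) * wall_product (n + 1) (B + 1) (c + 1)"
  proof (cases c)
    case 0
    \<comment> \<open>For \<open>c = 0\<close> the minor without the first row is strictly upper triangular.\<close>
    have "fdet (n + 1) (\<lambda>i. wall_entry B c (Suc i)) = (\<Prod>i<n + 1. wall_entry B c (Suc i) i)"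
      by (rule fdet_upper_triangular) (auto simp: wall_entry_def 0)
    also have "\<dots> = 0" by (auto simp: wall_entry_def 0)
    finally show ?thesis using wall_product_condensation_0[of n B] 0 by simp
  next
    case (Suc c')
    have "fdet (n + 1) (\<lambda>i. wall_entry B c (Suc i)) = wall_product (n + 1) (B + 2) c'"
      using ge2.IH(2)[of c' "B + 2"] ge2.prems Suc unfolding wall_entry_shift(2)[of B c', folded Suc_eq_plus1] Suc by simp
    then show ?thesis using wall_product_condensation[of c' B n] ge2.prems Suc by simp
  qed
  with dj have "fdet (n + 2) (wall_entry B c) * wall_product n (B + 3) c = wall_product (n + 2) B c * wall_product n (B + 3) c"
    unfolding IH by simp
  then show ?case using wall_product_neq_0[of n "B + 3" c] by simp
qed

lemma pochhammer_fact_quot: "pochhammer (real (Suc n)) k = fact (n + k) / fact n"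
proof (induction k)
  case (Suc k)
  have "pochhammer (real (Suc n)) (Suc k) = pochhammer (real (Suc n)) k * (real (Suc n) + real k)"
    by (simp only: pochhammer_Suc)
  also have "\<dots> = fact (n + k) / fact n * real (Suc (n + k))"
    unfolding Suc.IH by simp
  also have "\<dots> = fact (n + Suc k) / fact n" by (simp add: mult.commute)
  finally show ?case .
qed simp

text \<open>
  The product formula of the theorem, as a rearrangement of \<open>wall_product\<close>. Every Pochhammer symbol
  is a quotient of factorials; the two outside the product supply the boundary factors that arise
  when a product of factorials in arithmetic progression is shifted by one step.
\<close>

lemma wall_product_formula:
  assumes "c \<le> B + 1" and b: "b = B + a"
  shows "(1/2) ^ c * ((\<Prod>m<a. real (B + 2 * c + 3 * m + 2) / 2) * wall_product a B c) =
    (1/2) ^ (c + a) *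
    (pochhammer (real b + 2 * real c - real a + 2) a / pochhammer (real a + real b - real c + 2) a) *
    (\<Prod>j = 1..a.
       (fact (j - 1) * fact (b + c - a + 2 * j - 1)
         * pochhammer (real b - real a - real c + 2 * real j + 2) j
         * pochhammer (real b + 2 * real c - real a + 3 * real j + 2) (a - j))
       / (fact (b + 2 * j - 1) * fact (c + a - j)))"
proof -
  obtain e where e: "B + 1 = c + e" using assms(1) by (metis le_iff_add)
  have eB: "B + 1 - c = e" using e by simp
  have re: "real B = real c + real e - 1" using e by linarith
  let ?v = "B + 2 * c + 1" and ?w = "B + 2 * c + 1 + a"
  have p1: "pochhammer (real b + 2 * real c - real a + 2) a = fact ?w / fact ?v"
  proof -
    have "real b + 2 * real c - real a + 2 = real (Suc ?v)" by (simp add: b)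
    then show ?thesis by (simp only: pochhammer_fact_quot)
  qed
  have p2: "pochhammer (real a + real b - real c + 2) a = fact (e + 3 * a) / fact (e + 2 * a)"
  proof -
    have "real a + real b - real c + 2 = real (Suc (e + 2 * a))" by (simp add: b re)
    moreover have "e + 2 * a + a = e + 3 * a" by simp
    ultimately show ?thesis by (simp only: pochhammer_fact_quot)
  qed
  have factor_eq: "(fact (j - 1) * fact (b + c - a + 2 * j - 1)
         * pochhammer (real b - real a - real c + 2 * real j + 2) j
         * pochhammer (real b + 2 * real c - real a + 3 * real j + 2) (a - j))
       / (fact (b + 2 * j - 1) * fact (c + a - j)) =
     (fact i * fact (B + c + 1 + 2 * i) * (fact (e + 3 + 3 * i) / fact (e + 2 + 2 * i)) * (fact (?w + 2 + 2 * i) / fact (?v + 3 + 3 * i)))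
       / (fact (B + a + 1 + 2 * i) * fact (c + (a - Suc i)))"
    if i: "i < a" and j: "j = Suc i" for i j
  proof -
    have "real b - real a - real c + 2 * real j + 2 = real (Suc (e + 2 + 2 * i))" by (simp add: b re j)
    moreover have "e + 2 + 2 * i + j = e + 3 + 3 * i" using j by simp
    ultimately have 1: "pochhammer (real b - real a - real c + 2 * real j + 2) j = fact (e + 3 + 3 * i) / fact (e + 2 + 2 * i)"
      by (simp only: pochhammer_fact_quot)
    have "real b + 2 * real c - real a + 3 * real j + 2 = real (Suc (?v + 3 + 3 * i))" by (simp add: b j)
    moreover have "?v + 3 + 3 * i + (a - j) = ?w + 2 + 2 * i" using j i by simp
    ultimately have 2: "pochhammer (real b + 2 * real c - real a + 3 * real j + 2) (a - j) = fact (?w + 2 + 2 * i) / fact (?v + 3 + 3 * i)"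
      by (simp only: pochhammer_fact_quot)
    have 3: "j - 1 = i" "b + c - a + 2 * j - 1 = B + c + 1 + 2 * i" "b + 2 * j - 1 = B + a + 1 + 2 * i" "c + a - j = c + (a - Suc i)"
      using i j by (auto simp: b)
    show ?thesis unfolding 1 2 3 ..
  qed
  let ?X = "\<lambda>j. (fact (j - 1) * fact (b + c - a + 2 * j - 1)
         * pochhammer (real b - real a - real c + 2 * real j + 2) j
         * pochhammer (real b + 2 * real c - real a + 3 * real j + 2) (a - j))
       / (fact (b + 2 * j - 1) * fact (c + a - j)) :: real"
  have "(\<Prod>j = 1..a. ?X j) = (\<Prod>i<a. ?X (Suc i))"
    by (simp only: One_nat_def prod.atLeast1_atMost_eq)
  also have "\<dots> = (\<Prod>i<a. (fact i * fact (B + c + 1 + 2 * i) * (fact (e + 3 + 3 * i) / fact (e + 2 + 2 * i)) * (fact (?w + 2 + 2 * i) / fact (?v + 3 + 3 * i)))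
       / (fact (B + a + 1 + 2 * i) * fact (c + (a - Suc i))))"
    by (rule prod.cong[OF refl], rule factor_eq) simp_all
  also have "\<dots> = (fact_prod 1 a 0 * fact_prod 2 a (B + c + 1) * (fact_prod 3 a (e + 3) / fact_prod 2 a (e + 2)) *
      (fact_prod 2 a (?w + 2) / fact_prod 3 a (?v + 3))) / (fact_prod 2 a (B + a + 1) * fact_prod 1 a c)"
  proof -
    have "(\<Prod>i<a. fact (c + (a - Suc i))) = (fact_prod 1 a c :: real)"
      unfolding fact_prod_def using prod.nat_diff_reindex[of "\<lambda>i. fact (c + i) :: real" a] by simp
    then show ?thesis by (simp add: prod_dividef prod.distrib fact_prod_def)
  qed
  finally have R: "(\<Prod>j = 1..a. ?X j) =
       (fact_prod 1 a 0 * fact_prod 2 a (B + c + 1) * (fact_prod 3 a (e + 3) / fact_prod 2 a (e + 2)) *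
      (fact_prod 2 a (?w + 2) / fact_prod 3 a (?v + 3))) / (fact_prod 2 a (B + a + 1) * fact_prod 1 a c)" .
  have shift: "fact_prod k a (u + k) = fact_prod k a u * fact (u + k * a) / fact u" for k u
    using fact_prod_front[of k a u] fact_prod_back[of k a u] by (simp add: field_simps)
  have L: "(\<Prod>m<a. real (B + 2 * c + 3 * m + 2) / 2) = (1/2) ^ a * (fact_prod 3 a (B + 2 * c + 2) / fact_prod 3 a ?v)"
  proof -
    have "fact_prod 3 a (B + 2 * c + 2) = (\<Prod>m<a. real (B + 2 * c + 3 * m + 2)) * fact_prod 3 a ?v"
      unfolding fact_prod_def prod.distrib[symmetric]
    proof (rule prod.cong)
      fix m
      have "B + 2 * c + 2 + 3 * m = Suc (?v + 3 * m)" "Suc (?v + 3 * m) = B + 2 * c + 3 * m + 2" by simp_all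
      then show "fact (B + 2 * c + 2 + 3 * m) = real (B + 2 * c + 3 * m + 2) * fact (?v + 3 * m)"
        using fact_Suc[of "?v + 3 * m", where 'a = real] by simp
    qed simp
    then show ?thesis using fact_prod_pos[of 3 a ?v] by (simp add: prod_dividef power_one_over divide_simps)
  qed
  have vw: "?v + 3 * a = ?w + 2 * a" "B + 2 * c + a + 1 = ?w" by simp_all
  note nz = fact_prod_pos[THEN less_imp_neq, THEN not_sym]
  show ?thesis
    unfolding R p1 p2 L shift[of 3 e] shift[of 2 e] shift[of 2 ?w] shift[of 3 ?v] wall_product_def eB vw
    by (simp add: power_add nz field_simps del: fact_Suc)
qed
section \<open>Unit triangles and lozenges\<close>

text \<open>
  Both triangles are indexed by the lower endpoint of their edge in direction \<open>f\<close>. Thus \<open>up p\<close> and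
  \<open>down p\<close> share this edge and lie to its right and to its left, respectively.
\<close>

definition up :: "lattice_point \<Rightarrow> triangle" where
  "up p = {p, p + vec_e, p + vec_f}"

definition down :: "lattice_point \<Rightarrow> triangle" where
  "down p = {p, p + vec_f, p + vec_g}"

lemma up_Pair: "up (x, y) = {(x, y), (x + 1, y), (x, y + 1)}"
  by (simp add: up_def vec_e_def vec_f_def)

lemma down_Pair: "down (x, y) = {(x, y), (x, y + 1), (x - 1, y + 1)}"
  by (simp add: down_def vec_e_def vec_f_def vec_g_def)

lemma unit_triangle_iff: "unit_triangle T \<longleftrightarrow> T \<in> range up \<union> range down"
  by (auto simp: unit_triangle_def up_def down_def)

text \<open>
  The sum of the vertices, three times the centre of the triangle, determines both its position
  and, modulo 3, its orientation.
\<close>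

lemma sum_up: "(\<Sum>q\<in>up (x, y). fst q) = 3 * x + 1" "(\<Sum>q\<in>up (x, y). snd q) = 3 * y + 1"
  by (simp_all add: up_Pair)

lemma sum_down: "(\<Sum>q\<in>down (x, y). fst q) = 3 * x - 1" "(\<Sum>q\<in>down (x, y). snd q) = 3 * y + 2"
  by (simp_all add: down_Pair)

lemma up_inject [simp]: "up p = up q \<longleftrightarrow> p = q"
proof
  assume eq: "up p = up q"
  obtain x y x' y' where [simp]: "p = (x, y)" "q = (x', y')" by (metis surj_pair)
  show "p = q" using sum_up[of x y] sum_up[of x' y'] eq by simp
qed simp

lemma down_inject [simp]: "down p = down q \<longleftrightarrow> p = q"
proof
  assume eq: "down p = down q"
  obtain x y x' y' where [simp]: "p = (x, y)" "q = (x', y')" by (metis surj_pair)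
  show "p = q" using sum_down[of x y] sum_down[of x' y'] eq by simp
qed simp

lemma up_neq_down [simp]: "up p \<noteq> down q" "down q \<noteq> up p"
proof -
  obtain x y x' y' where [simp]: "p = (x, y)" "q = (x', y')" by (metis surj_pair)
  show "up p \<noteq> down q"
  proof
    assume "up p = down q"
    then have "3 * y + 1 = 3 * y' + 2" using sum_up(2)[of x y] sum_down(2)[of x' y'] by simp
    then show False by presburger
  qed
  then show "down q \<noteq> up p" by metis
qed

lemma card_up_up: "card (up p \<inter> up q) \<noteq> 2"
proof
  assume *: "card (up p \<inter> up q) = 2"
  obtain x y x' y' where [simp]: "p = (x, y)" "q = (x', y')" by (metis surj_pair)
  obtain u v where uv: "up p \<inter> up q = {u, v}" "u \<noteq> v" using * by (auto simp: card_2_iff)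
  then have "u \<in> up p" "v \<in> up p" "u \<in> up q" "v \<in> up q" by auto
  then have "p = q" using uv(2) by (auto simp: up_Pair)
  then show False using * by (simp add: up_Pair)
qed

lemma card_down_down: "card (down p \<inter> down q) \<noteq> 2"
proof
  assume *: "card (down p \<inter> down q) = 2"
  obtain x y x' y' where [simp]: "p = (x, y)" "q = (x', y')" by (metis surj_pair)
  obtain u v where uv: "down p \<inter> down q = {u, v}" "u \<noteq> v" using * by (auto simp: card_2_iff)
  then have "u \<in> down p" "v \<in> down p" "u \<in> down q" "v \<in> down q" by auto
  then have "p = q" using uv(2) by (auto simp: down_Pair)
  then show False using * by (simp add: down_Pair)
qed

lemma card_up_down: "card (up (x, y) \<inter> down q) = 2 \<longleftrightarrow> q \<in> {(x, y), (x + 1, y), (x + 1, y - 1)}"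
proof
  assume *: "card (up (x, y) \<inter> down q) = 2"
  obtain x' y' where [simp]: "q = (x', y')" by (metis surj_pair)
  obtain u v where uv: "up (x, y) \<inter> down q = {u, v}" "u \<noteq> v" using * by (auto simp: card_2_iff)
  then have "u \<in> up (x, y)" "v \<in> up (x, y)" "u \<in> down q" "v \<in> down q" by auto
  then show "q \<in> {(x, y), (x + 1, y), (x + 1, y - 1)}" using uv(2) by (auto simp: down_Pair up_Pair)
next
  assume "q \<in> {(x, y), (x + 1, y), (x + 1, y - 1)}"
  then show "card (up (x, y) \<inter> down q) = 2"
  proof (elim insertE emptyE)
    assume "q = (x, y)"
    then have "up (x, y) \<inter> down q = {(x, y), (x, y + 1)}" by (auto simp: down_Pair up_Pair)
    then show ?thesis by simp
  next
    assume "q = (x + 1, y)"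
    then have "up (x, y) \<inter> down q = {(x + 1, y), (x, y + 1)}" by (auto simp: down_Pair up_Pair)
    then show ?thesis by simp
  next
    assume "q = (x + 1, y - 1)"
    then have "up (x, y) \<inter> down q = {(x + 1, y), (x, y)}" by (auto simp: down_Pair up_Pair)
    then show ?thesis by simp
  qed
qed

lemma lozenge_iff:
  "lozenge L \<longleftrightarrow> (\<exists>x y q. L = {up (x, y), down q} \<and> q \<in> {(x, y), (x + 1, y), (x + 1, y - 1)})"
proof
  assume "lozenge L"
  then obtain T V where TV: "unit_triangle T" "unit_triangle V" "card (T \<inter> V) = 2" "L = {T, V}"
    by (auto simp: lozenge_def)
  have "\<exists>p q. card (up p \<inter> down q) = 2 \<and> L = {up p, down q}"
  proof -
    consider p q where "T = up p" "V = up q" | p q where "T = down p" "V = down q"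
      | p q where "T = up p" "V = down q" | p q where "T = down q" "V = up p"
      using TV(1,2) unfolding unit_triangle_iff by blast
    then show ?thesis
    proof cases
      case 4
      then have "card (up p \<inter> down q) = 2" "L = {up p, down q}"
        using TV(3,4) by (simp_all add: Int_commute insert_commute)
      then show ?thesis by blast
    qed (use TV card_up_up card_down_down in auto)
  qed
  then show "\<exists>x y q. L = {up (x, y), down q} \<and> q \<in> {(x, y), (x + 1, y), (x + 1, y - 1)}"
    using card_up_down by (metis surj_pair)
next
  assume "\<exists>x y q. L = {up (x, y), down q} \<and> q \<in> {(x, y), (x + 1, y), (x + 1, y - 1)}"
  then show "lozenge L" unfolding lozenge_def unit_triangle_iff card_up_down[symmetric] by blast
qed

lemma lozenge_up_down: "lozenge {up (x, y), down q} \<longleftrightarrow> q \<in> {(x, y), (x + 1, y), (x + 1, y - 1)}"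
  unfolding lozenge_iff by (auto simp: doubleton_eq_iff)

section \<open>Weighted tilings and their recursion\<close>

definition tiling_sum :: "(region \<Rightarrow> real) \<Rightarrow> region \<Rightarrow> real" where
  "tiling_sum w R = (\<Sum>\<T> | lozenge_tiling R \<T>. \<Prod>L\<in>\<T>. w L)"

lemma lozenge_tiling_subset: "lozenge_tiling R \<T> \<Longrightarrow> \<T> \<subseteq> Pow R"
  by (auto simp: lozenge_tiling_def partition_on_def)

lemma finite_lozenge_tilings: "finite R \<Longrightarrow> finite {\<T>. lozenge_tiling R \<T>}"
  by (rule finite_subset[of _ "Pow (Pow R)"]) (use lozenge_tiling_subset in auto)

lemma lozenge_tiling_empty: "lozenge_tiling {} \<T> \<longleftrightarrow> \<T> = {}"
  by (auto simp: lozenge_tiling_def partition_on_def)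

lemma tiling_sum_empty [simp]: "tiling_sum w {} = 1"
  by (simp add: tiling_sum_def lozenge_tiling_empty)

text \<open>
  A tiling is the same thing as the lozenge covering \<open>t\<close> together with a tiling of the rest.
\<close>

lemma tiling_sum_peel:
  assumes R: "finite R" and t: "t \<in> R"
  shows "tiling_sum w R = (\<Sum>L | lozenge L \<and> t \<in> L \<and> L \<subseteq> R. w L * tiling_sum w (R - L))"
proof -
  let ?Ls = "{L. lozenge L \<and> t \<in> L \<and> L \<subseteq> R}"
  have fin: "finite ?Ls" by (rule finite_subset[of _ "Pow R"]) (use R in auto)
  have ins: "lozenge_tiling R (insert L \<T>)" if "L \<in> ?Ls" "lozenge_tiling (R - L) \<T>" for L \<T>
  proof -
    have "disjnt L (\<Union>\<T>)" using that(2) by (auto simp: lozenge_tiling_def partition_on_def disjnt_def)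
    then show ?thesis using that by (auto simp: lozenge_tiling_def partition_on_insert)
  qed
  have notin: "L \<notin> \<T>" "finite \<T>" if "L \<in> ?Ls" "lozenge_tiling (R - L) \<T>" for L \<T>
    using that R finite_subset[of "\<T>" "Pow (R - L)"] lozenge_tiling_subset[of "R - L" \<T>] by auto
  have uniq: "L' = L" if "L \<in> ?Ls" "lozenge_tiling (R - L) \<T>" "L' \<in> insert L \<T>" "t \<in> L'" for L L' \<T>
    using that lozenge_tiling_subset[of "R - L" \<T>] by auto
  define blk where "blk = (\<lambda>\<T>. THE L. L \<in> \<T> \<and> t \<in> L)"
  have blk: "blk \<T> \<in> \<T>" "t \<in> blk \<T>" if "lozenge_tiling R \<T>" for \<T>
  proof -
    have p: "partition_on R \<T>" using that by (simp add: lozenge_tiling_def)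
    obtain L where "L \<in> \<T>" "t \<in> L" using partition_onD1[OF p] t by blast
    moreover have "L' = L" if "L' \<in> \<T>" "t \<in> L'" for L'
      using disjointD[OF partition_onD2[OF p], of L' L] that \<open>L \<in> \<T>\<close> \<open>t \<in> L\<close> by blast
    ultimately have "\<exists>!L. L \<in> \<T> \<and> t \<in> L" by blast
    from theI'[OF this] show "blk \<T> \<in> \<T>" "t \<in> blk \<T>" by (simp_all add: blk_def)
  qed
  have rem: "lozenge_tiling (R - L) (\<T> - {L})" if "lozenge_tiling R \<T>" "L \<in> \<T>" for \<T> L
  proof -
    have p: "partition_on R \<T>" using that by (simp add: lozenge_tiling_def)
    have "L \<inter> M = {}" if "M \<in> \<T> - {L}" for M
      using disjointD[OF partition_onD2[OF p], of L M] that \<open>L \<in> \<T>\<close> by blast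
    then have d: "disjnt L (\<Union>(\<T> - {L}))" unfolding disjnt_def by blast
    have "insert L (\<T> - {L}) = \<T>" using that by blast
    then have "partition_on (R - L) (\<T> - {L})" using p partition_on_insert[OF d, of R] by simp
    then show ?thesis using that by (simp add: lozenge_tiling_def)
  qed
  have "(\<Sum>L\<in>?Ls. w L * tiling_sum w (R - L)) =
      (\<Sum>L\<in>?Ls. \<Sum>\<T> | lozenge_tiling (R - L) \<T>. \<Prod>M\<in>insert L \<T>. w M)"
    unfolding tiling_sum_def sum_distrib_left using notin by (intro sum.cong refl) auto
  also have "\<dots> = (\<Sum>(L, \<T>)\<in>Sigma ?Ls (\<lambda>L. {\<T>. lozenge_tiling (R - L) \<T>}). \<Prod>M\<in>insert L \<T>. w M)"
    using fin R by (intro sum.Sigma) (auto intro: finite_lozenge_tilings)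
  also have "\<dots> = (\<Sum>\<T> | lozenge_tiling R \<T>. \<Prod>L\<in>\<T>. w L)"
  proof (rule sum.reindex_bij_witness[where j = "\<lambda>(L, \<T>). insert L \<T>" and i = "\<lambda>\<T>. (blk \<T>, \<T> - {blk \<T>})"])
    fix \<T> assume "\<T> \<in> {\<T>. lozenge_tiling R \<T>}"
    then have T: "lozenge_tiling R \<T>" by simp
    note b = blk[OF T]
    have "blk \<T> \<subseteq> R" "lozenge (blk \<T>)" using b(1) T by (auto simp: lozenge_tiling_def partition_on_def)
    then show "(blk \<T>, \<T> - {blk \<T>}) \<in> Sigma ?Ls (\<lambda>L. {\<T>. lozenge_tiling (R - L) \<T>})"
      using b rem[OF T b(1)] by simp
    show "(case (blk \<T>, \<T> - {blk \<T>}) of (L, \<T>) \<Rightarrow> insert L \<T>) = \<T>" using b(1) by auto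
  next
    fix p assume p: "p \<in> Sigma ?Ls (\<lambda>L. {\<T>. lozenge_tiling (R - L) \<T>})"
    obtain L \<T> where [simp]: "p = (L, \<T>)" by (metis surj_pair)
    from p have L: "L \<in> ?Ls" "lozenge_tiling (R - L) \<T>" by auto
    have "blk (insert L \<T>) = L" unfolding blk_def using uniq[OF L] L(1) by (intro the_equality) auto
    then show "(blk (case p of (L, \<T>) \<Rightarrow> insert L \<T>), (case p of (L, \<T>) \<Rightarrow> insert L \<T>) - {blk (case p of (L, \<T>) \<Rightarrow> insert L \<T>)}) = p"
      using notin(1)[OF L] by simp
    show "(case p of (L, \<T>) \<Rightarrow> insert L \<T>) \<in> {\<T>. lozenge_tiling R \<T>}" using ins[OF L] by simp
  qed auto
  finally show ?thesis by (simp add: tiling_sum_def)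
qed

section \<open>Transfer across a vertical strip\<close>

definition region_sum :: "(region \<Rightarrow> real) \<Rightarrow> lattice_point set \<Rightarrow> lattice_point set \<Rightarrow> real" where
  "region_sum w A B = tiling_sum w (up ` A \<union> down ` B)"

lemma region_Diff:
  "(up ` A \<union> down ` B) - {up p, down q} = up ` (A - {p}) \<union> down ` (B - {q})"
  by auto

lemma region_sum_peel_down:
  assumes "finite A" "finite B" "(x, y) \<in> B"
  shows "region_sum w A B =
    (\<Sum>p\<in>{(x, y), (x - 1, y), (x - 1, y + 1)} \<inter> A. w {up p, down (x, y)} * region_sum w (A - {p}) (B - {(x, y)}))"
proof -
  have "region_sum w A B = (\<Sum>L | lozenge L \<and> down (x, y) \<in> L \<and> L \<subseteq> up ` A \<union> down ` B.
      w L * tiling_sum w ((up ` A \<union> down ` B) - L))"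
    unfolding region_sum_def using assms by (intro tiling_sum_peel) auto
  also have "{L. lozenge L \<and> down (x, y) \<in> L \<and> L \<subseteq> up ` A \<union> down ` B} =
      (\<lambda>p. {up p, down (x, y)}) ` ({(x, y), (x - 1, y), (x - 1, y + 1)} \<inter> A)"
    (is "?lhs = ?rhs")
  proof
    show "?lhs \<subseteq> ?rhs" by (auto simp: lozenge_iff)
    show "?rhs \<subseteq> ?lhs" using assms(3) by (auto simp: lozenge_up_down)
  qed
  also have "(\<Sum>L\<in>\<dots>. w L * tiling_sum w ((up ` A \<union> down ` B) - L)) =
     (\<Sum>p\<in>{(x, y), (x - 1, y), (x - 1, y + 1)} \<inter> A. w {up p, down (x, y)} * region_sum w (A - {p}) (B - {(x, y)}))"
    by (subst sum.reindex) (auto simp: inj_on_def doubleton_eq_iff region_Diff region_sum_def)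
  finally show ?thesis .
qed

lemma region_sum_peel_up:
  assumes "finite A" "finite B" "(x, y) \<in> A"
  shows "region_sum w A B =
    (\<Sum>q\<in>{(x, y), (x + 1, y), (x + 1, y - 1)} \<inter> B. w {up (x, y), down q} * region_sum w (A - {(x, y)}) (B - {q}))"
proof -
  have "region_sum w A B = (\<Sum>L | lozenge L \<and> up (x, y) \<in> L \<and> L \<subseteq> up ` A \<union> down ` B.
      w L * tiling_sum w ((up ` A \<union> down ` B) - L))"
    unfolding region_sum_def using assms by (intro tiling_sum_peel) auto
  also have "{L. lozenge L \<and> up (x, y) \<in> L \<and> L \<subseteq> up ` A \<union> down ` B} =
      (\<lambda>q. {up (x, y), down q}) ` ({(x, y), (x + 1, y), (x + 1, y - 1)} \<inter> B)"
    (is "?lhs = ?rhs")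
  proof
    show "?lhs \<subseteq> ?rhs" by (auto simp: lozenge_iff)
    show "?rhs \<subseteq> ?lhs" using assms(3) by (auto simp: lozenge_up_down)
  qed
  also have "(\<Sum>L\<in>\<dots>. w L * tiling_sum w ((up ` A \<union> down ` B) - L)) =
     (\<Sum>q\<in>{(x, y), (x + 1, y), (x + 1, y - 1)} \<inter> B. w {up (x, y), down q} * region_sum w (A - {(x, y)}) (B - {q}))"
    by (subst sum.reindex) (auto simp: inj_on_def doubleton_eq_iff region_Diff region_sum_def)
  finally show ?thesis .
qed

definition left_of :: "int \<Rightarrow> lattice_point set \<Rightarrow> lattice_point set" where
  "left_of x A = {p \<in> A. fst p < x}"

definition column :: "int \<Rightarrow> lattice_point set \<Rightarrow> int set" where
  "column x A = {y. (x, y) \<in> A}"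

text \<open>
  The weight of the tilings of everything to the left of the line \<open>x\<close>, including, on that line, only the
  triangles \<open>down (x, y)\<close> with \<open>y \<in> S\<close>: the others are covered by lozenges crossing the line.
  The function \<open>strip_sum\<close> describes a partially matched strip: the sets \<open>P\<close> and \<open>R\<close> hold the heights
  of the remaining triangles \<open>up\<close> and \<open>down\<close> at the line \<open>x\<close>, the set \<open>S\<close> those at the line \<open>x + 1\<close>.
\<close>

definition left_sum where
  "left_sum w A B x S = region_sum w (left_of x A) (left_of x B \<union> Pair x ` S)"

definition strip_sum where
  "strip_sum w A B x P R S = region_sum w (left_of x A \<union> Pair x ` P) (left_of x B \<union> Pair x ` R \<union> Pair (x + 1) ` S)"

lemma finite_left_of [simp]: "finite A \<Longrightarrow> finite (left_of x A)"
  by (simp add: left_of_def)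

lemma finite_column [simp]: "finite A \<Longrightarrow> finite (column x A)"
  using finite_vimageI[of A "Pair x"] by (simp add: column_def vimage_def inj_on_def)

lemma left_of_Suc: "left_of (x + 1) A = left_of x A \<union> Pair x ` column x A"
  by (auto simp: left_of_def column_def image_iff)

lemma left_sum_Suc: "left_sum w A B (x + 1) S = strip_sum w A B x (column x A) (column x B) S"
  by (simp add: left_sum_def strip_sum_def left_of_Suc)

lemma strip_sum_peel_right:
  assumes fin: "finite A" "finite B" "finite P" "finite R" "finite S" and y: "y \<in> S"
  shows "strip_sum w A B x P R S =
    (if y \<in> P then w {up (x, y), down (x + 1, y)} * strip_sum w A B x (P - {y}) R (S - {y}) else 0) +
    (if y + 1 \<in> P then w {up (x, y + 1), down (x + 1, y)} * strip_sum w A B x (P - {y + 1}) R (S - {y}) else 0)"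
proof -
  let ?A = "left_of x A \<union> Pair x ` P" and ?B = "left_of x B \<union> Pair x ` R \<union> Pair (x + 1) ` S"
  have A: "?A - {(x, z)} = left_of x A \<union> Pair x ` (P - {z})" for z
    by (auto simp: left_of_def)
  have B: "?B - {(x + 1, y)} = left_of x B \<union> Pair x ` R \<union> Pair (x + 1) ` (S - {y})"
    by (auto simp: left_of_def)
  have N: "{(x + 1, y), (x + 1 - 1, y), (x + 1 - 1, y + 1)} \<inter> ?A = Pair x ` ({y, y + 1} \<inter> P)"
    by (auto simp: left_of_def)
  have "strip_sum w A B x P R S =
      (\<Sum>p\<in>Pair x ` ({y, y + 1} \<inter> P). w {up p, down (x + 1, y)} * region_sum w (?A - {p}) (?B - {(x + 1, y)}))"
    unfolding strip_sum_def N[symmetric] by (rule region_sum_peel_down) (use fin y in auto)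
  also have "\<dots> = (\<Sum>z\<in>{y, y + 1} \<inter> P. w {up (x, z), down (x + 1, y)} * strip_sum w A B x (P - {z}) R (S - {y}))"
    by (subst sum.reindex) (auto simp: inj_on_def A B strip_sum_def)
  also have "{y, y + 1} \<inter> P = (if y \<in> P then {y} else {}) \<union> (if y + 1 \<in> P then {y + 1} else {})" by auto
  finally show ?thesis by (simp split: if_splits)
qed

lemma strip_sum_peel_left:
  assumes fin: "finite A" "finite B" "finite P" "finite R" and y: "y \<in> P"
  shows "strip_sum w A B x P R {} =
    (if y \<in> R then w {up (x, y), down (x, y)} * strip_sum w A B x (P - {y}) (R - {y}) {} else 0)"
proof -
  let ?A = "left_of x A \<union> Pair x ` P" and ?B = "left_of x B \<union> Pair x ` R"
  have A: "?A - {(x, y)} = left_of x A \<union> Pair x ` (P - {y})"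
    by (auto simp: left_of_def)
  have B: "?B - {(x, y)} = left_of x B \<union> Pair x ` (R - {y})"
    by (auto simp: left_of_def)
  have N: "{(x, y), (x + 1, y), (x + 1, y - 1)} \<inter> ?B = (if y \<in> R then {(x, y)} else {})"
    by (auto simp: left_of_def)
  have "strip_sum w A B x P R {} =
      (\<Sum>q\<in>(if y \<in> R then {(x, y)} else {}). w {up (x, y), down q} * region_sum w (?A - {(x, y)}) (?B - {q}))"
    unfolding strip_sum_def N[symmetric] using region_sum_peel_up[of ?A ?B x y w] fin y by simp
  then show ?thesis by (simp add: A B strip_sum_def)
qed

text \<open>
  When nothing remains at the line \<open>x + 1\<close>, every triangle \<open>up\<close> left over must be matched across the
  line \<open>x\<close>.
\<close>

lemma strip_sum_left:
  assumes fin: "finite A" "finite B" "finite P" "finite R"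
  shows "strip_sum w A B x P R {} =
    (if P \<subseteq> R then (\<Prod>y\<in>P. w {up (x, y), down (x, y)}) * left_sum w A B x (R - P) else 0)"
  using fin(3,4)
proof (induction P arbitrary: R rule: finite_induct)
  case empty
  show ?case by (simp add: strip_sum_def left_sum_def)
next
  case (insert y P)
  have "strip_sum w A B x (insert y P) R {} =
      (if y \<in> R then w {up (x, y), down (x, y)} * strip_sum w A B x P (R - {y}) {} else 0)"
    using strip_sum_peel_left[of A B "insert y P" R y w x] fin insert by simp
  also have "strip_sum w A B x P (R - {y}) {} =
    (if P \<subseteq> R - {y} then (\<Prod>y\<in>P. w {up (x, y), down (x, y)}) * left_sum w A B x (R - {y} - P) else 0)"
    using insert by simp
  also have "R - {y} - P = R - insert y P" by auto
  finally show ?case using insert.hyps by auto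
qed

text \<open>
  In the strip to the right of the line \<open>x\<close>, the triangle \<open>down (x + 1, y)\<close> can be matched with
  \<open>up (x, y)\<close>, when a particle keeps the height \<open>y\<close>, or with \<open>up (x, y + 1)\<close>, when it descends to \<open>y\<close>.
\<close>

definition step_row :: "(region \<Rightarrow> real) \<Rightarrow> int \<Rightarrow> int set \<Rightarrow> (int \<Rightarrow> nat \<Rightarrow> real) \<Rightarrow> int \<Rightarrow> nat \<Rightarrow> real" where
  "step_row w x P \<phi> y = (\<lambda>i.
     (if y \<in> P then w {up (x, y), down (x + 1, y)} else 0) * \<phi> y i +
     (if y + 1 \<in> P then w {up (x, y + 1), down (x + 1, y)} else 0) * \<phi> (y + 1) i)"

text \<open>
  Here \<open>zs\<close> are the particles on the line \<open>x\<close> already chosen and \<open>ys\<close> those on the line \<open>x + 1\<close> not yet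
  matched, from top to bottom. Matching the highest one expands its row of the determinant by
  linearity. If the chosen height has been used before, the tiling term is absent and the determinant
  has two equal rows. Otherwise the list \<open>zs\<close> remains decreasing, because a particle moves by at
  most one. The rows \<open>fr\<close> belong to particles that have not entered yet.
\<close>

lemma strip_transfer:
  fixes \<phi> :: "int \<Rightarrow> nat \<Rightarrow> real"
  assumes fin: "finite A" "finite B" "finite P" "finite R"
    and base: "\<And>zs. sorted_wrt (>) zs \<Longrightarrow> set zs \<subseteq> P \<Longrightarrow> length zs = n \<Longrightarrow>
      strip_sum w A B x (P - set zs) R {} = K * row_det (fr @ map \<phi> zs)"
    and ys: "sorted_wrt (>) ys" "sorted_wrt (>) zs" "set zs \<subseteq> P" "length zs + length ys = n"
      "\<And>y z. y \<in> set ys \<Longrightarrow> z \<in> set zs \<Longrightarrow> z > y"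
  shows "strip_sum w A B x (P - set zs) R (set ys) = K * row_det (fr @ map \<phi> zs @ map (step_row w x P \<phi>) ys)"
  using ys
proof (induction ys arbitrary: zs)
  case Nil
  then show ?case using base[of zs] by simp
next
  case (Cons y ys)
  let ?D = "\<lambda>zs. row_det (fr @ map \<phi> zs @ map (step_row w x P \<phi>) ys)"
  have y: "y \<notin> set ys" using Cons.prems(1) by auto
  have step: "(if z \<in> P - set zs then u * strip_sum w A B x (P - set zs - {z}) R (set ys) else 0) =
      K * ((if z \<in> P then u else 0) * ?D (zs @ [z]))" if z: "z = y \<or> z = y + 1" for z u
  proof (cases "z \<in> P")
    case True
    show ?thesis
    proof (cases "z \<in> set zs")
      case True
      then have "?D (zs @ [z]) = 0"
        using row_det_eq_0_if_repeated[of "\<phi> z" "fr @ map \<phi> zs" "map (step_row w x P \<phi>) ys"] by simp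
      then show ?thesis using True by simp
    next
      case False
      have "z < z'" if "z' \<in> set zs" for z'
      proof -
        have "y < z'" "z \<noteq> z'" using Cons.prems(5)[of y z'] that False by auto
        then show ?thesis using z by linarith
      qed
      then have "sorted_wrt (>) (zs @ [z])"
        using Cons.prems(2) by (simp add: sorted_wrt_append)
      moreover have "z' > y'" if "y' \<in> set ys" "z' \<in> set (zs @ [z])" for y' z'
        using that Cons.prems(1,5) z by auto
      ultimately have "strip_sum w A B x (P - set (zs @ [z])) R (set ys) = K * ?D (zs @ [z])"
        using Cons.IH[of "zs @ [z]"] Cons.prems \<open>z \<in> P\<close> by simp
      moreover have "P - set zs - {z} = P - set (zs @ [z])" by auto
      ultimately show ?thesis using False \<open>z \<in> P\<close> by simp
    qed
  qed simp
  have "row_det (fr @ map \<phi> zs @ map (step_row w x P \<phi>) (y # ys)) =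
      (if y \<in> P then w {up (x, y), down (x + 1, y)} else 0) * ?D (zs @ [y]) +
      (if y + 1 \<in> P then w {up (x, y + 1), down (x + 1, y)} else 0) * ?D (zs @ [y + 1])"
    using row_det_linear[of "fr @ map \<phi> zs" _ "\<phi> y" _ "\<phi> (y + 1)" "map (step_row w x P \<phi>) ys"]
    by (simp add: step_row_def[of w x P \<phi> y])
  then have *: "K * row_det (fr @ map \<phi> zs @ map (step_row w x P \<phi>) (y # ys)) =
      K * ((if y \<in> P then w {up (x, y), down (x + 1, y)} else 0) * ?D (zs @ [y])) +
      K * ((if y + 1 \<in> P then w {up (x, y + 1), down (x + 1, y)} else 0) * ?D (zs @ [y + 1]))"
    by (simp only: distrib_left)
  have ys: "set (y # ys) - {y} = set ys" using y by auto
  have peel: "strip_sum w A B x (P - set zs) R (set (y # ys)) =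
    (if y \<in> P - set zs then w {up (x, y), down (x + 1, y)} * strip_sum w A B x (P - set zs - {y}) R (set ys) else 0) +
    (if y + 1 \<in> P - set zs then w {up (x, y + 1), down (x + 1, y)} * strip_sum w A B x (P - set zs - {y + 1}) R (set ys) else 0)"
    unfolding ys[symmetric] by (rule strip_sum_peel_right) (use fin in auto)
  show ?case
    unfolding * peel
    by (rule arg_cong2[where f = "(+)"]; rule step) simp_all
qed

lemma distinct_if_decreasing:
  fixes xs :: "'a :: linorder list"
  shows "sorted_wrt (>) xs \<Longrightarrow> distinct xs"
  by (induction xs) auto

section \<open>The trimmed hexagon in lattice coordinates\<close>

text \<open>
  The embedding of the lattice extended to real coordinates \<open>(u, v)\<close>. In these coordinates the hexagon is
  cut out by bounds on \<open>u\<close>, on \<open>v\<close> and on \<open>u + v\<close>.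
\<close>

definition plane :: "real \<times> real \<Rightarrow> real \<times> real" where
  "plane p = (fst p + snd p / 2, snd p * (sqrt 3 / 2))"

lemma embed_plane: "embed (x, y) = plane (of_int x, of_int y)"
  by (simp add: embed_def plane_def)

lemma linear_plane: "linear plane"
  by (rule linearI) (auto simp: plane_def algebra_simps add_divide_distrib)

lemma inj_plane: "inj plane"
  by (rule injI) (auto simp: plane_def prod_eq_iff)

definition hexagon_plane :: "nat \<Rightarrow> nat \<Rightarrow> nat \<Rightarrow> (real \<times> real) set" where
  "hexagon_plane a b c = {(0, 0), (real b, 0), (real b, real a), (real b - real c, real a + real c), (- real c, real a + real c), (- real c, real c)}"

lemma embed_hexagon_vertices: "embed ` hexagon_vertices a b c = plane ` hexagon_plane a b c"
  by (simp add: hexagon_vertices_def hexagon_plane_def vec_e_def vec_f_def vec_g_def lscale_def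
      zero_prod_def embed_plane)

lemma convex_combination:
  fixes K :: "(real \<times> real) set"
  assumes "convex K" "(u1, v1) \<in> K" "(u2, v2) \<in> K" "0 \<le> t" "t \<le> 1"
    "u = (1 - t) * u1 + t * u2" "v = (1 - t) * v1 + t * v2"
  shows "(u, v) \<in> K"
  using convexD[OF assms(1-3), of "1 - t" t] assms(4-7) by simp

lemma convex_horizontal:
  fixes K :: "(real \<times> real) set"
  assumes "convex K" "(u1, v) \<in> K" "(u2, v) \<in> K" "u1 \<le> u" "u \<le> u2"
  shows "(u, v) \<in> K"
proof (cases "u1 = u2")
  case False
  define t where "t = (u - u1) / (u2 - u1)"
  have t: "t * (u2 - u1) = u - u1" "0 \<le> t" "t \<le> 1"
    using False assms(4,5) by (simp_all add: t_def)
  show ?thesis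
    by (rule convex_combination[OF assms(1-3) t(2,3)]) (use t(1) in \<open>simp_all add: algebra_simps\<close>)
qed (use assms in auto)

text \<open>
  A point that satisfies the six inequalities lies on a horizontal segment between the left and the
  right boundary of the hexagon, and the endpoints of that segment lie on sides.
\<close>

lemma hull_hexagon_plane:
  assumes "a > 0" "c > 0"
  shows "(u, v) \<in> convex hull (hexagon_plane a b c) \<longleftrightarrow>
    - real c \<le> u \<and> u \<le> b \<and> 0 \<le> v \<and> v \<le> real a + c \<and> 0 \<le> u + v \<and> u + v \<le> real a + b"
    (is "_ \<longleftrightarrow> ?R")
proof
  let ?K = "{p :: real \<times> real. inner (1, 0) p \<le> b} \<inter> {p. inner (1, 0) p \<ge> - real c} \<inter> {p. inner (0, 1) p \<ge> 0} \<inter>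
      {p. inner (0, 1) p \<le> real a + c} \<inter> {p. inner (1, 1) p \<ge> 0} \<inter> {p. inner (1, 1) p \<le> real a + b}"
  have "convex ?K" by (intro convex_Int convex_halfspace_le convex_halfspace_ge)
  moreover have "hexagon_plane a b c \<subseteq> ?K" by (auto simp: hexagon_plane_def)
  ultimately have "convex hull (hexagon_plane a b c) \<subseteq> ?K" by (intro hull_minimal)
  then show "(u, v) \<in> convex hull (hexagon_plane a b c) \<Longrightarrow> ?R" by auto
next
  assume R: ?R
  let ?K = "convex hull (hexagon_plane a b c)"
  have K: "convex ?K" by simp
  have V: "(0, 0) \<in> ?K" "(real b, 0) \<in> ?K" "(real b, real a) \<in> ?K"
    "(real b - real c, real a + real c) \<in> ?K" "(- real c, real a + real c) \<in> ?K" "(- real c, real c) \<in> ?K"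
    by (auto intro!: hull_inc simp: hexagon_plane_def)
  have l: "(if v \<le> real c then - v else - real c, v) \<in> ?K"
  proof (cases "v \<le> c")
    case True
    have "(- v, v) \<in> ?K"
      by (rule convex_combination[OF K V(1,6), of "v / c"]) (use True R assms in auto)
    then show ?thesis using True by simp
  next
    case False
    have "(- real c, v) \<in> ?K"
      by (rule convex_combination[OF K V(6,5), of "(v - c) / a"]) (use False R assms in \<open>auto simp: field_simps\<close>)
    then show ?thesis using False by simp
  qed
  have r: "(if v \<le> real a then real b else real a + b - v, v) \<in> ?K"
  proof (cases "v \<le> a")
    case True
    have "(real b, v) \<in> ?K"
      by (rule convex_combination[OF K V(2,3), of "v / a"]) (use True R assms in \<open>auto simp: field_simps\<close>)
    then show ?thesis using True by simp
  next
    case False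
    have "(real a + b - v, v) \<in> ?K"
      by (rule convex_combination[OF K V(3,4), of "(v - a) / c"]) (use False R assms in \<open>auto simp: field_simps\<close>)
    then show ?thesis using False by simp
  qed
  show "(u, v) \<in> ?K"
    by (rule convex_horizontal[OF K l r]) (use R in auto)
qed

lemma hexagon_iff:
  assumes "a > 0" "c > 0"
  shows "T \<in> hexagon a b c \<longleftrightarrow> unit_triangle T \<and> (\<forall>(x, y)\<in>T.
    - int c \<le> x \<and> x \<le> b \<and> 0 \<le> y \<and> y \<le> int a + c \<and> 0 \<le> x + y \<and> x + y \<le> int a + b)"
proof -
  have point: "embed (x, y) \<in> convex hull (embed ` hexagon_vertices a b c) \<longleftrightarrow>
    - int c \<le> x \<and> x \<le> b \<and> 0 \<le> y \<and> y \<le> int a + c \<and> 0 \<le> x + y \<and> x + y \<le> int a + b" for x y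
  proof -
    have "embed (x, y) \<in> convex hull (embed ` hexagon_vertices a b c) \<longleftrightarrow>
        (real_of_int x, real_of_int y) \<in> convex hull (hexagon_plane a b c)"
      unfolding embed_hexagon_vertices convex_hull_linear_image[OF linear_plane, symmetric] embed_plane
      by (rule inj_image_mem_iff[OF inj_plane])
    also have "\<dots> \<longleftrightarrow> - int c \<le> x \<and> x \<le> b \<and> 0 \<le> y \<and> y \<le> int a + c \<and> 0 \<le> x + y \<and> x + y \<le> int a + b"
      unfolding hull_hexagon_plane[OF assms] by linarith
    finally show ?thesis .
  qed
  have "convex hull (embed ` T) \<subseteq> convex hull (embed ` hexagon_vertices a b c) \<longleftrightarrow>
      embed ` T \<subseteq> convex hull (embed ` hexagon_vertices a b c)"
    by (rule subset_hull) simp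
  also have "\<dots> \<longleftrightarrow> (\<forall>(x, y)\<in>T. embed (x, y) \<in> convex hull (embed ` hexagon_vertices a b c))" by auto
  finally show ?thesis unfolding hexagon_def point by simp
qed

lemma unit_triangle_up_down: "unit_triangle (up p)" "unit_triangle (down p)"
  by (auto simp: unit_triangle_iff)

lemma up_in_hexagon:
  assumes "a > 0" "c > 0"
  shows "up (x, y) \<in> hexagon a b c \<longleftrightarrow>
    - int c \<le> x \<and> x < b \<and> 0 \<le> y \<and> y < int a + c \<and> 0 \<le> x + y \<and> x + y < int a + b"
  unfolding hexagon_iff[OF assms] using unit_triangle_up_down by (auto simp: up_Pair)

lemma down_in_hexagon:
  assumes "a > 0" "c > 0"
  shows "down (x, y) \<in> hexagon a b c \<longleftrightarrow>
    - int c < x \<and> x \<le> b \<and> 0 \<le> y \<and> y < int a + c \<and> 0 \<le> x + y \<and> x + y < int a + b"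
  unfolding hexagon_iff[OF assms] using unit_triangle_up_down by (auto simp: down_Pair)

lemma triangles_in_ef:
  "{T. unit_triangle T \<and> T \<subseteq> {(x, y + 1), (x + 1, y + 1), (x + 1, y), (x, y)}} = {up (x, y), down (x + 1, y)}"
    (is "{T. _ \<and> T \<subseteq> ?S} = ?R")
proof (intro equalityI subsetI)
  fix T assume "T \<in> {T. unit_triangle T \<and> T \<subseteq> ?S}"
  then consider p where "T = up p" "up p \<subseteq> ?S" | p where "T = down p" "down p \<subseteq> ?S"
    unfolding unit_triangle_iff by auto
  then show "T \<in> ?R"
  proof cases
    case (1 p)
    then have "p = (x, y)" by (cases p) (auto simp: up_Pair)
    with 1 show ?thesis by simp
  next
    case (2 p)
    then have "p = (x + 1, y)" by (cases p) (auto simp: down_Pair)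
    with 2 show ?thesis by simp
  qed
next
  fix T assume "T \<in> ?R"
  moreover have "up (x, y) \<subseteq> ?S" "down (x + 1, y) \<subseteq> ?S" by (auto simp: up_Pair down_Pair)
  ultimately show "T \<in> {T. unit_triangle T \<and> T \<subseteq> ?S}" using unit_triangle_up_down by auto
qed

lemma triangles_in_eg:
  "{T. unit_triangle T \<and> T \<subseteq> {(x, y + 1), (x - 1, y + 1), (x, y), (x + 1, y)}} = {up (x, y), down (x, y)}"
    (is "{T. _ \<and> T \<subseteq> ?S} = ?R")
proof (intro equalityI subsetI)
  fix T assume "T \<in> {T. unit_triangle T \<and> T \<subseteq> ?S}"
  then consider p where "T = up p" "up p \<subseteq> ?S" | p where "T = down p" "down p \<subseteq> ?S"
    unfolding unit_triangle_iff by auto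
  then show "T \<in> ?R"
  proof cases
    case (1 p)
    then have "p = (x, y)" by (cases p) (auto simp: up_Pair)
    with 1 show ?thesis by simp
  next
    case (2 p)
    then have "p = (x, y)" by (cases p) (auto simp: down_Pair)
    with 2 show ?thesis by simp
  qed
next
  fix T assume "T \<in> ?R"
  moreover have "up (x, y) \<subseteq> ?S" "down (x, y) \<subseteq> ?S" by (auto simp: up_Pair down_Pair)
  ultimately show "T \<in> {T. unit_triangle T \<and> T \<subseteq> ?S}" using unit_triangle_up_down by auto
qed

lemma lscale_Pair: "k *\<^sub>L (x, y) = (k * x, k * y)"
  by (simp add: lscale_def)

lemma uminus_vecs: "- vec_e = (- 1, 0)" "- vec_f = (0, - 1)" "- vec_g = (1, - 1)"
  by (simp_all add: vec_e_def vec_f_def vec_g_def)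

lemma corner_coords:
  "nw_corner a b c = (- int c, int a + int c)"
  "ne_corner a b c = (int b - int c, int a + int c)"
  by (simp_all add: nw_corner_def ne_corner_def vec_e_def vec_f_def vec_g_def lscale_Pair)

lemma nw_point:
  "nw_corner a b c + i *\<^sub>L vec_e + j *\<^sub>L (- vec_f) = (i - int c, int a + int c - j)"
  unfolding corner_coords uminus_vecs vec_e_def lscale_Pair by simp

lemma ne_point:
  "ne_corner a b c + i *\<^sub>L (- vec_e) + j *\<^sub>L (- vec_g) = (int b - int c + j - i, int a + int c - j)"
  unfolding corner_coords uminus_vecs lscale_Pair by simp

lemma cell_nw:
  "cell (nw_corner a b c) vec_e (- vec_f) i j =
     {up (i - 1 - int c, int a + int c - j), down (i - int c, int a + int c - j)}"
  using triangles_in_ef[of "i - 1 - int c" "int a + int c - j"]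
  unfolding cell_def nw_point by (simp add: algebra_simps)

lemma cell_ne:
  "cell (ne_corner a b c) (- vec_e) (- vec_g) i j =
     {up (int b - int c + j - i, int a + int c - j), down (int b - int c + j - i, int a + int c - j)}"
  using triangles_in_eg[of "int b - int c + j - i" "int a + int c - j"]
  unfolding cell_def ne_point by (simp add: algebra_simps)

lemma in_staircase:
  "T \<in> staircase V s t m \<longleftrightarrow> (\<exists>i j. 1 \<le> i \<and> 1 \<le> j \<and> i + j \<le> int m \<and> T \<in> cell V s t i j)"
  unfolding staircase_def by blast

lemma in_marked_positions:
  "L \<in> marked_positions V s t m \<longleftrightarrow> (\<exists>i j. 1 \<le> i \<and> 1 \<le> j \<and> i + j = int m + 1 \<and> L = cell V s t i j)"
  unfolding marked_positions_def by blast

text \<open>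
  Solving for the indices \<open>i\<close>, \<open>j\<close> of a cell at the northwestern corner from the position of its
  triangles; \<open>ex_coordinates'\<close> does the same at the northeastern corner.
\<close>

lemma ex_coordinates:
  fixes d e :: int
  shows "(\<exists>i j. 1 \<le> i \<and> 1 \<le> j \<and> Q i j \<and> x = i + d \<and> y = e - j) \<longleftrightarrow>
    1 \<le> x - d \<and> 1 \<le> e - y \<and> Q (x - d) (e - y)"
proof
  assume "\<exists>i j. 1 \<le> i \<and> 1 \<le> j \<and> Q i j \<and> x = i + d \<and> y = e - j"
  then obtain i j where *: "1 \<le> i" "1 \<le> j" "Q i j" "x = i + d" "y = e - j" by blast
  then have ij: "x - d = i" "e - y = j" by linarith+
  show "1 \<le> x - d \<and> 1 \<le> e - y \<and> Q (x - d) (e - y)"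
    unfolding ij using *(1-3) by blast
next
  assume "1 \<le> x - d \<and> 1 \<le> e - y \<and> Q (x - d) (e - y)"
  then show "\<exists>i j. 1 \<le> i \<and> 1 \<le> j \<and> Q i j \<and> x = i + d \<and> y = e - j"
    by (intro exI[of _ "x - d"] exI[of _ "e - y"]) auto
qed

lemma ex_coordinates':
  fixes d e :: int
  shows "(\<exists>i j. 1 \<le> i \<and> 1 \<le> j \<and> Q i j \<and> x = d + j - i \<and> y = e - j) \<longleftrightarrow>
    1 \<le> d + e - x - y \<and> 1 \<le> e - y \<and> Q (d + e - x - y) (e - y)"
proof
  assume "\<exists>i j. 1 \<le> i \<and> 1 \<le> j \<and> Q i j \<and> x = d + j - i \<and> y = e - j"
  then obtain i j where *: "1 \<le> i" "1 \<le> j" "Q i j" "x = d + j - i" "y = e - j" by blast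
  then have ij: "d + e - x - y = i" "e - y = j" by linarith+
  show "1 \<le> d + e - x - y \<and> 1 \<le> e - y \<and> Q (d + e - x - y) (e - y)"
    unfolding ij using *(1-3) by blast
next
  assume "1 \<le> d + e - x - y \<and> 1 \<le> e - y \<and> Q (d + e - x - y) (e - y)"
  then show "\<exists>i j. 1 \<le> i \<and> 1 \<le> j \<and> Q i j \<and> x = d + j - i \<and> y = e - j"
  proof (intro exI conjI)
    show "x = d + (e - y) - (d + e - x - y)" "y = e - (e - y)" by linarith+
  qed blast+
qed

lemma up_in_nw:
  "up (x, y) \<in> staircase (nw_corner a b c) vec_e (- vec_f) m \<longleftrightarrow>
    - int c \<le> x \<and> y < int a + int c \<and> y > x + int a + 2 * int c - int m"
proof -
  have "up (x, y) \<in> staircase (nw_corner a b c) vec_e (- vec_f) m \<longleftrightarrow>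
    (\<exists>i j. 1 \<le> i \<and> 1 \<le> j \<and> i + j \<le> int m \<and> x = i + (- 1 - int c) \<and> y = (int a + int c) - j)"
    unfolding in_staircase cell_nw by (intro ex_cong1) auto
  then show ?thesis unfolding ex_coordinates by linarith
qed

lemma down_in_nw:
  "down (x, y) \<in> staircase (nw_corner a b c) vec_e (- vec_f) m \<longleftrightarrow>
    - int c < x \<and> y < int a + int c \<and> y \<ge> x + int a + 2 * int c - int m"
proof -
  have "down (x, y) \<in> staircase (nw_corner a b c) vec_e (- vec_f) m \<longleftrightarrow>
    (\<exists>i j. 1 \<le> i \<and> 1 \<le> j \<and> i + j \<le> int m \<and> x = i + (- int c) \<and> y = (int a + int c) - j)"
    unfolding in_staircase cell_nw by (intro ex_cong1) auto
  then show ?thesis unfolding ex_coordinates by linarith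
qed

lemma up_in_ne:
  "up (x, y) \<in> staircase (ne_corner a b c) (- vec_e) (- vec_g) m \<longleftrightarrow>
    x + y < int a + int b \<and> y < int a + int c \<and> x + 2 * y \<ge> 2 * int a + int b + int c - int m"
proof -
  have "up (x, y) \<in> staircase (ne_corner a b c) (- vec_e) (- vec_g) m \<longleftrightarrow>
    (\<exists>i j. 1 \<le> i \<and> 1 \<le> j \<and> i + j \<le> int m \<and> x = (int b - int c) + j - i \<and> y = (int a + int c) - j)"
    unfolding in_staircase cell_ne by simp
  then show ?thesis unfolding ex_coordinates' by linarith
qed

lemma down_in_ne:
  "down (x, y) \<in> staircase (ne_corner a b c) (- vec_e) (- vec_g) m \<longleftrightarrow>
    x + y < int a + int b \<and> y < int a + int c \<and> x + 2 * y \<ge> 2 * int a + int b + int c - int m"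
proof -
  have "down (x, y) \<in> staircase (ne_corner a b c) (- vec_e) (- vec_g) m \<longleftrightarrow>
    (\<exists>i j. 1 \<le> i \<and> 1 \<le> j \<and> i + j \<le> int m \<and> x = (int b - int c) + j - i \<and> y = (int a + int c) - j)"
    unfolding in_staircase cell_ne by simp
  then show ?thesis unfolding ex_coordinates' by linarith
qed

text \<open>
  The last two inequalities describe the two cuts: \<open>y = x + 2 c\<close> is the line through the notches
  of the northwestern one, and \<open>x + 2 y = 2 a + b - 1\<close> that through the notches of the northeastern
  one. The triangles \<open>up\<close> and \<open>down\<close> at a notch of the northwestern cut lie on different lines,
  whence the strict inequality for \<open>down\<close>.
\<close>

definition Ha_up :: "nat \<Rightarrow> nat \<Rightarrow> nat \<Rightarrow> lattice_point set" where
  "Ha_up a b c = {(x, y). - int c \<le> x \<and> x < b \<and> 0 \<le> y \<and> 0 \<le> x + y \<and> y < int a + c \<and> y \<le> x + 2 * int c \<and> x + 2 * y < 2 * int a + b}"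

definition Ha_down :: "nat \<Rightarrow> nat \<Rightarrow> nat \<Rightarrow> lattice_point set" where
  "Ha_down a b c = {(x, y). - int c < x \<and> x \<le> b \<and> 0 \<le> y \<and> 0 \<le> x + y \<and> y < int a + c \<and> y < x + 2 * int c \<and> x + 2 * y < 2 * int a + b}"

lemma finite_Ha_up [simp]: "finite (Ha_up a b c)"
proof (rule finite_subset)
  show "Ha_up a b c \<subseteq> {- int c..int b} \<times> {0..int a + int c}" by (auto simp: Ha_up_def)
qed simp

lemma finite_Ha_down [simp]: "finite (Ha_down a b c)"
proof (rule finite_subset)
  show "Ha_down a b c \<subseteq> {- int c..int b} \<times> {0..int a + int c}" by (auto simp: Ha_down_def)
qed simp

lemma Ha_eq:
  assumes "a > 0" "c > 0" "b \<ge> a + c - 1"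
  shows "Ha a b c = up ` Ha_up a b c \<union> down ` Ha_down a b c"
proof -
  have m: "min b a = a" "min b c = c" using assms by auto
  have u: "up (x, y) \<in> Ha a b c \<longleftrightarrow> (x, y) \<in> Ha_up a b c" for x y
  proof -
    let ?hex = "- int c \<le> x \<and> x < int b \<and> 0 \<le> y \<and> y < int a + int c \<and> 0 \<le> x + y \<and> x + y < int a + int b"
    have "up (x, y) \<in> Ha a b c \<longleftrightarrow>
        ?hex \<and> up (x, y) \<notin> staircase (nw_corner a b c) vec_e (- vec_f) a \<and>
        up (x, y) \<notin> staircase (ne_corner a b c) (- vec_e) (- vec_g) c"
      unfolding Ha_def m Diff_iff Un_iff up_in_hexagon[OF assms(1,2)] by blast
    also have "\<dots> \<longleftrightarrow> ?hex \<and> y \<le> x + 2 * int c \<and> x + 2 * y < 2 * int a + int b"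
      unfolding up_in_nw up_in_ne by (rule conj_cong[OF refl]) (auto simp: not_less not_le)
    also have "\<dots> \<longleftrightarrow> (x, y) \<in> Ha_up a b c"
      unfolding Ha_up_def mem_Collect_eq prod.case by (intro iffI conjI; (elim conjE)?; linarith)
    finally show ?thesis .
  qed
  have d: "down (x, y) \<in> Ha a b c \<longleftrightarrow> (x, y) \<in> Ha_down a b c" for x y
  proof -
    let ?hex = "- int c < x \<and> x \<le> int b \<and> 0 \<le> y \<and> y < int a + int c \<and> 0 \<le> x + y \<and> x + y < int a + int b"
    have "down (x, y) \<in> Ha a b c \<longleftrightarrow>
        ?hex \<and> down (x, y) \<notin> staircase (nw_corner a b c) vec_e (- vec_f) a \<and>
        down (x, y) \<notin> staircase (ne_corner a b c) (- vec_e) (- vec_g) c"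
      unfolding Ha_def m Diff_iff Un_iff down_in_hexagon[OF assms(1,2)] by blast
    also have "\<dots> \<longleftrightarrow> ?hex \<and> y < x + 2 * int c \<and> x + 2 * y < 2 * int a + int b"
      unfolding down_in_nw down_in_ne by (rule conj_cong[OF refl]) (auto simp: not_less not_le)
    also have "\<dots> \<longleftrightarrow> (x, y) \<in> Ha_down a b c"
      unfolding Ha_down_def mem_Collect_eq prod.case by (intro iffI conjI; (elim conjE)?; linarith)
    finally show ?thesis .
  qed
  show ?thesis
  proof (intro equalityI subsetI)
    fix T assume T: "T \<in> Ha a b c"
    then have "unit_triangle T" by (simp add: Ha_def hexagon_def)
    then consider x y where "T = up (x, y)" | x y where "T = down (x, y)"
      unfolding unit_triangle_iff by auto
    then show "T \<in> up ` Ha_up a b c \<union> down ` Ha_down a b c" using T u d by cases auto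
  next
    fix T assume "T \<in> up ` Ha_up a b c \<union> down ` Ha_down a b c"
    then show "T \<in> Ha a b c" using u d by auto
  qed
qed

definition Ha_weight :: "nat \<Rightarrow> nat \<Rightarrow> nat \<Rightarrow> region \<Rightarrow> real" where
  "Ha_weight a b c L = (if L \<in> Ha_marked a b c then 1 / 2 else 1)"

lemma in_marked_nw:
  "{up (x, y), down q} \<in> marked_positions (nw_corner a b c) vec_e (- vec_f) a \<longleftrightarrow>
    q = (x + 1, y) \<and> - int c \<le> x \<and> y < int a + int c \<and> y = x + 2 * int c"
proof -
  have "{up (x, y), down q} \<in> marked_positions (nw_corner a b c) vec_e (- vec_f) a \<longleftrightarrow>
    (\<exists>i j. 1 \<le> i \<and> 1 \<le> j \<and> (i + j = int a + 1 \<and> q = (x + 1, y)) \<and> x = i + (- 1 - int c) \<and> y = (int a + int c) - j)"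
    unfolding in_marked_positions cell_nw by (intro ex_cong1) (auto simp: doubleton_eq_iff)
  then show ?thesis unfolding ex_coordinates by auto
qed

lemma in_marked_ne:
  "{up (x, y), down q} \<in> marked_positions (ne_corner a b c) (- vec_e) (- vec_g) c \<longleftrightarrow>
    q = (x, y) \<and> x + y < int a + int b \<and> y < int a + int c \<and> x + 2 * y = 2 * int a + int b - 1"
proof -
  have "{up (x, y), down q} \<in> marked_positions (ne_corner a b c) (- vec_e) (- vec_g) c \<longleftrightarrow>
    (\<exists>i j. 1 \<le> i \<and> 1 \<le> j \<and> (i + j = int c + 1 \<and> q = (x, y)) \<and> x = (int b - int c) + j - i \<and> y = (int a + int c) - j)"
    unfolding in_marked_positions cell_ne by (intro ex_cong1) (auto simp: doubleton_eq_iff)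
  then show ?thesis unfolding ex_coordinates' by auto
qed

lemma Ha_weights:
  assumes "a > 0" "c > 0" "b \<ge> a + c - 1" "(x, y) \<in> Ha_up a b c"
  shows "Ha_weight a b c {up (x, y), down (x + 1, y)} = (if y = x + 2 * int c then 1 / 2 else 1)"
    and "Ha_weight a b c {up (x, y), down (x + 1, y - 1)} = 1"
    and "Ha_weight a b c {up (x, y), down (x, y)} = (if x + 2 * y = 2 * int a + b - 1 then 1 / 2 else 1)"
proof -
  have m: "min b a = a" "min b c = c" using assms(1-3) by auto
  have p: "- int c \<le> x" "y < int a + int c" "x < int b" using assms(4) by (simp_all add: Ha_up_def)
  have s: "x + y < int a + int b" if "x + 2 * y = 2 * int a + int b - 1" using that p by linarith
  note marked = Ha_weight_def Ha_marked_def m Un_iff in_marked_nw in_marked_ne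
  show "Ha_weight a b c {up (x, y), down (x + 1, y)} = (if y = x + 2 * int c then 1 / 2 else 1)"
    unfolding marked using p by simp
  show "Ha_weight a b c {up (x, y), down (x + 1, y - 1)} = 1"
    unfolding marked by simp
  show "Ha_weight a b c {up (x, y), down (x, y)} = (if x + 2 * y = 2 * int a + b - 1 then 1 / 2 else 1)"
    unfolding marked using p s by simp
qed

lemma weighted_count_Ha_eq:
  assumes "a > 0" "c > 0" "b \<ge> a + c - 1"
  shows "weighted_count_Ha a b c = region_sum (Ha_weight a b c) (Ha_up a b c) (Ha_down a b c)"
proof -
  have "(1 / 2) ^ card (\<T> \<inter> Ha_marked a b c) = (\<Prod>L\<in>\<T>. Ha_weight a b c L)" if "lozenge_tiling (Ha a b c) \<T>" for \<T>
  proof -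
    have "finite (Ha a b c)" using Ha_eq[OF assms] by simp
    then have "finite \<T>" using lozenge_tiling_subset[OF that] finite_subset by blast
    then show ?thesis by (simp add: Ha_weight_def prod.If_cases Collect_mem_eq)
  qed
  then show ?thesis
    unfolding weighted_count_Ha_def region_sum_def tiling_sum_def Ha_eq[OF assms] by (simp add: Ha_eq[OF assms])
qed
section \<open>Lattice walks whose first step is weighted\<close>

definition ichoose :: "nat \<Rightarrow> int \<Rightarrow> real" where
  "ichoose N d = (if d < 0 then 0 else real (N choose nat d))"

lemma ichoose_Suc: "ichoose (Suc N) d = ichoose N d + ichoose N (d - 1)"
proof (cases "d \<le> 0")
  case False
  then obtain k where "d = int (Suc k)" by (metis not_le zero_less_imp_eq_int gr0_implies_Suc of_nat_0_less_iff)
  then show ?thesis by (simp add: ichoose_def nat_add_distrib)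
qed (auto simp: ichoose_def)

lemma ichoose_eq_0: "d < 0 \<or> d > int N \<Longrightarrow> ichoose N d = 0"
  by (auto simp: ichoose_def binomial_eq_0 zless_nat_eq_int_zless)

text \<open>
  Walks of \<open>N\<close> steps with \<open>d\<close> descents, where the first step has weight \<open>1/2\<close> if it is level. From
  the second step on they satisfy Pascal's recursion (\<open>half_walks_Suc\<close>).
\<close>

fun half_walks :: "nat \<Rightarrow> int \<Rightarrow> real" where
  "half_walks 0 d = (if d = 0 then 1 else 0)"
| "half_walks (Suc N) d = ichoose N d / 2 + ichoose N (d - 1)"

lemma half_walks_eq_0: "d < 0 \<or> d > int N \<Longrightarrow> half_walks N d = 0"
  by (cases N) (auto simp: ichoose_eq_0)

lemma half_walks_Suc: "N > 0 \<Longrightarrow> half_walks (Suc N) d = half_walks N d + half_walks N (d - 1)"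
  by (cases N) (simp_all add: ichoose_Suc[of _ d] ichoose_Suc[of _ "d - 1"] add_divide_distrib)

lemma ichoose_0: "ichoose 0 d = (if d = 0 then 1 else 0)"
  by (auto simp: ichoose_def binomial_eq_0)

lemma half_walks_1: "half_walks (Suc 0) d = half_walks 0 d / 2 + half_walks 0 (d - 1)"
  by (simp add: ichoose_0)

lemma sum_lessThan_add:
  fixes g :: "nat \<Rightarrow> 'a :: comm_monoid_add"
  shows "(\<Sum>t<p + q. g t) = (\<Sum>t<p. g t) + (\<Sum>t<q. g (p + t))"
  by (induction q) (simp_all add: add.assoc)

lemma half_walks_add:
  assumes "N > 0"
  shows "half_walks (N + n) d = (\<Sum>t<Suc n. real (n choose t) * half_walks N (d - int t))"
proof (induction n arbitrary: d)
  case (Suc n)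
  let ?g = "\<lambda>t. half_walks N (d - int t)"
  have 1: "half_walks (N + n) d = ?g 0 + (\<Sum>t<Suc n. real (n choose Suc t) * ?g (Suc t))"
  proof -
    have "half_walks (N + n) d = (\<Sum>t<Suc (Suc n). real (n choose t) * ?g t)" unfolding Suc.IH by simp
    then show ?thesis by (subst (asm) sum.lessThan_Suc_shift) simp
  qed
  have 2: "half_walks (N + n) (d - 1) = (\<Sum>t<Suc n. real (n choose t) * ?g (Suc t))"
    unfolding Suc.IH by (rule sum.cong) (simp_all add: algebra_simps)
  have "half_walks (N + Suc n) d = half_walks (N + n) d + half_walks (N + n) (d - 1)"
    using assms half_walks_Suc[of "N + n" d] by (simp del: half_walks.simps(2))
  also have "\<dots> = ?g 0 + (\<Sum>t<Suc n. real (Suc n choose Suc t) * ?g (Suc t))"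
    unfolding 1 2 by (simp add: sum.distrib[symmetric] algebra_simps del: sum.lessThan_Suc)
  also have "\<dots> = (\<Sum>t<Suc (Suc n). real (Suc n choose t) * ?g t)"
    by (subst sum.lessThan_Suc_shift) simp
  finally show ?case .
qed simp

text \<open>
  By \<open>half_walks_add\<close>, a walk with \<open>2 m + 1\<close> more steps is a sum over \<open>2 m + 2\<close> intermediate endpoints.
  These are paired by reflection, and paired endpoints have equal binomial coefficients.
\<close>

lemma half_walks_fold:
  assumes "N > 0" "m < a"
  shows "(\<Sum>k<a. (if k \<le> m then real (2 * m + 1 choose (m - k)) else 0) * (half_walks N (d + int k) + half_walks N (d - 1 - int k)))
    = half_walks (N + (2 * m + 1)) (d + int m)"
proof -
  let ?G = "\<lambda>t. real (2 * m + 1 choose t) * half_walks N (d + int m - int t)"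
  have "(\<Sum>k<a. (if k \<le> m then real (2 * m + 1 choose (m - k)) else 0) * (half_walks N (d + int k) + half_walks N (d - 1 - int k)))
      = (\<Sum>k<Suc m. real (2 * m + 1 choose (m - k)) * (half_walks N (d + int k) + half_walks N (d - 1 - int k)))"
    by (rule sum.mono_neutral_cong_right) (use assms in auto)
  also have "\<dots> = (\<Sum>k<Suc m. ?G (m - k)) + (\<Sum>k<Suc m. ?G (Suc m + k))"
  proof -
    have "?G (m - k) = real (2 * m + 1 choose (m - k)) * half_walks N (d + int k)"
      "?G (Suc m + k) = real (2 * m + 1 choose (m - k)) * half_walks N (d - 1 - int k)" if "k < Suc m" for k
    proof -
      show "?G (m - k) = real (2 * m + 1 choose (m - k)) * half_walks N (d + int k)"
        using that by (simp add: of_nat_diff)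
      have "2 * m + 1 choose (Suc m + k) = 2 * m + 1 choose (m - k)"
        using binomial_symmetric[of "Suc m + k" "2 * m + 1"] that by simp
      moreover have "d + int m - int (Suc m + k) = d - 1 - int k" by simp
      ultimately show "?G (Suc m + k) = real (2 * m + 1 choose (m - k)) * half_walks N (d - 1 - int k)"
        by (simp only:)
    qed
    then show ?thesis by (simp add: sum.distrib[symmetric] distrib_left del: sum.lessThan_Suc)
  qed
  also have "(\<Sum>k<Suc m. ?G (m - k)) = (\<Sum>t<Suc m. ?G t)"
    using sum.nat_diff_reindex[of ?G "Suc m"] by simp
  also have "(\<Sum>t<Suc m. ?G t) + (\<Sum>k<Suc m. ?G (Suc m + k)) = (\<Sum>t<Suc (2 * m + 1). ?G t)"
    using sum_lessThan_add[of ?G "Suc m" "Suc m"] by (simp add: mult_2 del: sum.lessThan_Suc)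
  finally show ?thesis unfolding half_walks_add[OF assms(1)] .
qed

lemma half_walks_closed:
  assumes "d \<le> N"
  shows "half_walks (Suc N) (int d) = real (N + 1 + d) / 2 * (fact N / (fact d * fact (N + 1 - d)))"
proof (cases d)
  case 0
  have "fact N / fact (N + 1) = 1 / real (N + 1)" by simp
  moreover have "real (N + 1) \<noteq> 0" by linarith
  ultimately show ?thesis unfolding 0 by (simp add: ichoose_def del: fact_Suc of_nat_Suc of_nat_add)
next
  case (Suc k)
  obtain e where N: "N = Suc k + e" using assms Suc by (metis le_iff_add)
  have k: "int (Suc k) - 1 = int k" by simp
  have "half_walks (Suc N) (int d) = real (N choose Suc k) / 2 + real (N choose k)"
    unfolding half_walks.simps Suc k ichoose_def nat_int by (simp del: of_nat_Suc)
  also have "real (N choose Suc k) = fact N / (fact (Suc k) * fact e)"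
    using binomial_fact[of "Suc k" N, where 'a = real] N by simp
  also have "real (N choose k) = fact N / (fact k * fact (Suc e))"
    using binomial_fact[of k N, where 'a = real] N by simp
  also have "fact N / (fact (Suc k) * fact e) / 2 + fact N / (fact k * fact (Suc e)) =
      real (N + 1 + d) / 2 * (fact N / (fact (Suc k) * fact (Suc e)))"
    by (simp add: N Suc divide_simps) (simp add: algebra_simps)
  finally show ?thesis using N Suc by simp
qed

lemma half_walks_wall_entry:
  "half_walks (B + c + 1 + i + (2 * m + 1)) (int c - int i + int m) = real (B + 2 * c + 3 * m + 2) / 2 * wall_entry B c i m"
proof (cases "i \<le> c + m")
  case True
  have "int c - int i + int m = int (c + m - i)" using True by simp
  moreover have "B + c + 1 + i + (2 * m + 1) = Suc (B + c + i + 2 * m + 1)" by simp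
  moreover have "B + c + i + 2 * m + 1 + 1 + (c + m - i) = B + 2 * c + 3 * m + 2"
    "B + c + i + 2 * m + 1 + 1 - (c + m - i) = B + 2 * i + m + 2" "c + m - i \<le> B + c + i + 2 * m + 1"
    using True by linarith+
  ultimately show ?thesis using half_walks_closed[of "c + m - i" "B + c + i + 2 * m + 1"] True
    by (simp only: wall_entry_def if_True)
next
  case False
  then have "int c - int i + int m < 0" by linarith
  then show ?thesis using False half_walks_eq_0[of "int c - int i + int m" "B + c + 1 + i + (2 * m + 1)"] by (simp add: wall_entry_def)
qed

section \<open>The transfer determinant of the trimmed hexagon\<close>

text \<open>
  The assumption on \<open>b\<close> makes every particle enter strictly below the wall.
\<close>

locale trimmed_hexagon =
  fixes a b c :: nat
  assumes a_pos: "a > 0" and c_pos: "c > 0" and b_large: "b \<ge> a + c - 1"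
begin

text \<open>
  The points with \<open>x + 2 y = H\<close> form the wall, the line through the notches of the northeastern cut.
\<close>

abbreviation "H \<equiv> 2 * int a + int b - 1"
abbreviation "A \<equiv> Ha_up a b c"
abbreviation "B \<equiv> Ha_down a b c"
abbreviation "w \<equiv> Ha_weight a b c"

text \<open>
  The starting height of the \<open>i\<close>-th particle, which enters at the line \<open>x = source i - 2 c\<close>.
\<close>

definition source :: "nat \<Rightarrow> int" where "source i = int a + int c - 1 - int i"

text \<open>
  Walks from the \<open>i\<close>-th source to height \<open>s\<close> on the line \<open>x\<close>, without the wall. Before it enters, a particle
  is regarded as waiting at its starting height; this is expressed by \<open>nat\<close>, which maps negative
  numbers of steps to \<open>0\<close>.
\<close>

definition free_walks :: "int \<Rightarrow> int \<Rightarrow> nat \<Rightarrow> real" where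
  "free_walks x s i = half_walks (nat (x + 2 * int c - source i)) (source i - s)"

text \<open>
  The reflection in the wall maps the height \<open>s\<close> on the line \<open>x\<close> to \<open>H - x - s\<close>. The two functions
  differ on the wall only: \<open>up_row\<close> includes the factor \<open>2\<close> for touching it at the line \<open>x\<close>, and
  \<open>down_row\<close> does not.
\<close>

definition up_row :: "int \<Rightarrow> int \<Rightarrow> nat \<Rightarrow> real" where
  "up_row x s i = free_walks x s i + free_walks x (H - x - s) i"

definition down_row :: "int \<Rightarrow> int \<Rightarrow> nat \<Rightarrow> real" where
  "down_row x s i = (if x + 2 * s = H then free_walks x s i else up_row x s i)"

lemma source_bounds: "i < a \<Longrightarrow> int c \<le> source i" "source i < int a + int c"
  by (auto simp: source_def)

lemma b_int: "int b \<ge> int a + int c - 1" using b_large a_pos c_pos by linarith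

lemma free_walks_waiting: "x + 2 * int c \<le> source i \<Longrightarrow> free_walks x s i = (if s = source i then 1 else 0)"
  by (simp add: free_walks_def)

lemma free_walks_above: "source i < s \<Longrightarrow> free_walks x s i = 0"
  by (simp add: free_walks_def half_walks_eq_0)

lemma free_walks_below: "source i - s > max 0 (x + 2 * int c - source i) \<Longrightarrow> free_walks x s i = 0"
  unfolding free_walks_def by (rule half_walks_eq_0) (simp add: max_def split: if_splits)

lemma free_walks_Suc: "source i < x + 2 * int c \<Longrightarrow> free_walks (x + 1) s i = free_walks x s i + free_walks x (s + 1) i"
proof -
  assume *: "source i < x + 2 * int c"
  then have "nat (x + 1 + 2 * int c - source i) = Suc (nat (x + 2 * int c - source i))" "nat (x + 2 * int c - source i) > 0"
    by linarith+
  then have "free_walks (x + 1) s i = free_walks x s i + half_walks (nat (x + 2 * int c - source i)) (source i - s - 1)"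
    unfolding free_walks_def by (simp add: half_walks_Suc del: half_walks.simps(2))
  moreover have "source i - s - 1 = source i - (s + 1)" by simp
  ultimately show ?thesis by (simp add: free_walks_def)
qed

lemma free_walks_start: "source i = x + 2 * int c \<Longrightarrow> free_walks (x + 1) s i = (if s = source i then 1 / 2 else if s + 1 = source i then 1 else 0)"
proof -
  assume *: "source i = x + 2 * int c"
  then have "nat (x + 1 + 2 * int c - source i) = Suc 0" by linarith
  then show ?thesis unfolding free_walks_def by (simp add: half_walks_1 del: half_walks.simps(2))
qed

lemma wait_below_wall:
  assumes "i < a" "x + 2 * int c \<le> source i"
  shows "x + 2 * source i < H"
  using assms source_bounds[of i] b_int by linarith

lemma up_row_waiting:
  assumes "i < a" "x + 2 * int c \<le> source i" "x + 2 * s \<le> H"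
  shows "up_row x s i = (if s = source i then 1 else 0)"
  using wait_below_wall[OF assms(1,2)] assms(2,3) by (auto simp: up_row_def free_walks_waiting)

lemma waiting_row:
  assumes "i < a" "x + 1 + 2 * int c \<le> s" "s < int a + int c"
  shows "up_row x s i = down_row (x + 1) s i"
proof -
  have low: "x + 1 + 2 * s < H" using assms b_int by linarith
  then have down: "down_row (x + 1) s i = up_row (x + 1) s i" by (simp add: down_row_def)
  show ?thesis
  proof (cases "x + 1 + 2 * int c \<le> source i")
    case True
    then show ?thesis unfolding down
      using up_row_waiting[OF assms(1), of x s] up_row_waiting[OF assms(1), of "x + 1" s] low by simp
  next
    case False
    then have "source i < s" "source i < H - x - s" "source i < H - (x + 1) - s" using assms(2) low by linarith+
    then show ?thesis unfolding down up_row_def by (simp add: free_walks_above)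
  qed
qed

lemma in_A: "(x, y) \<in> A \<longleftrightarrow> - int c \<le> x \<and> x < int b \<and> 0 \<le> y \<and> 0 \<le> x + y \<and> y < int a + int c \<and> y \<le> x + 2 * int c \<and> x + 2 * y \<le> H"
  by (auto simp: Ha_up_def)

lemma in_B: "(x, y) \<in> B \<longleftrightarrow> - int c < x \<and> x \<le> int b \<and> 0 \<le> y \<and> 0 \<le> x + y \<and> y < int a + int c \<and> y < x + 2 * int c \<and> x + 2 * y \<le> H"
  by (auto simp: Ha_down_def)

text \<open>
  The recursion for the walks, with the two cuts taken into account. Free walks satisfy it by Pascal's rule, and
  reflection exchanges its two terms. On the wall, the point above it is missing from the region, but
  it is the mirror image of the point from which the wall is reached. At the line where a particle
  enters, the weight \<open>1/2\<close> of the level step is that in \<open>half_walks\<close>.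
\<close>

lemma step_row_eq:
  assumes yB: "(x + 1, y) \<in> B" and i: "i < a"
  shows "step_row w x (column x A) (up_row x) y i = down_row (x + 1) y i"
proof -
  have y: "- int c \<le> x" "x < int b" "0 \<le> y" "0 \<le> x + 1 + y" "y < int a + int c" "y \<le> x + 2 * int c" "x + 2 * y < H"
    using yB unfolding in_B by auto
  have dist: "x + 2 * (y + 1) = x + 2 * y + 2" by simp
  have E: "(if y \<in> column x A then w {up (x, y), down (x + 1, y)} else 0) =
      (if (x, y) \<in> A then if y = x + 2 * int c then 1 / 2 else 1 else 0)"
    using Ha_weights(1)[OF a_pos c_pos b_large, of x y] by (auto simp: column_def)
  have D: "(if y + 1 \<in> column x A then w {up (x, y + 1), down (x + 1, y)} else 0) = (if (x, y + 1) \<in> A then 1 else 0)"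
    using Ha_weights(2)[OF a_pos c_pos b_large, of x "y + 1"] by (auto simp: column_def)
  have "(if (x, y) \<in> A then if y = x + 2 * int c then 1 / 2 else 1 else 0) * up_row x y i +
      (if (x, y + 1) \<in> A then 1 else 0) * up_row x (y + 1) i = down_row (x + 1) y i"
  proof -
    note sb = source_bounds(1)[OF i] source_bounds(2)[of i]
    consider "x + 2 * int c < source i" | "x + 2 * int c = source i" | "source i < x + 2 * int c" by linarith
    then show ?thesis
    proof cases
      case 1
      \<comment> \<open>The particle is still waiting at the line \<open>x + 1\<close>, so all four values vanish.\<close>
      have low: "x + 1 + 2 * source i < H" using wait_below_wall[of i "x + 1"] 1 i by simp
      have "up_row x y i = 0" using up_row_waiting[of i x y] 1 i y by simp
      moreover have "(if (x, y + 1) \<in> A then 1 else 0) * up_row x (y + 1) i = 0"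
      proof (cases "(x, y + 1) \<in> A")
        case True
        then have "y + 1 \<le> x + 2 * int c" "x + 2 * (y + 1) \<le> H" by (auto simp: in_A)
        then show ?thesis using up_row_waiting[of i x "y + 1"] 1 i by simp
      qed simp
      moreover have "up_row (x + 1) y i = 0" using up_row_waiting[of i "x + 1" y] 1 i y by simp
      moreover have "free_walks (x + 1) y i = 0" using free_walks_waiting[of "x + 1" i y] 1 y by simp
      ultimately show ?thesis by (simp add: down_row_def)
    next
      case 2
      \<comment> \<open>The particle enters at the line \<open>x\<close>.\<close>
      have low: "x + 2 * source i < H" using wait_below_wall[of i "x"] 2 i by simp
      have 3: "up_row x y i = (if y = source i then 1 else 0)" using up_row_waiting[of i x y] 2 i y by simp
      have 4: "(if (x, y + 1) \<in> A then 1 else 0) * up_row x (y + 1) i = (if y + 1 = source i then 1 else 0)"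
      proof (cases "(x, y + 1) \<in> A")
        case True
        then show ?thesis using up_row_waiting[of i x "y + 1"] 2 i by (simp add: in_A)
      next
        case False
        have "y + 1 \<noteq> source i"
        proof
          assume "y + 1 = source i"
          then have "(x, y + 1) \<in> A" unfolding in_A using 2 y sb low dist by (intro conjI; linarith)
          then show False using False by simp
        qed
        then show ?thesis using False by simp
      qed
      have 5: "(x, y) \<in> A" if "y = source i"
        unfolding in_A using that 2 y sb low by (intro conjI; linarith)
      have 6: "down_row (x + 1) y i = free_walks (x + 1) y i"
      proof (cases "x + 1 + 2 * y = H")
        case False
        have "free_walks (x + 1) (H - (x + 1) - y) i = 0"
          unfolding free_walks_start[OF 2[symmetric]] using False y low 2 by auto
        then show ?thesis using False by (simp add: down_row_def up_row_def)
      qed (simp add: down_row_def)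
      show ?thesis unfolding 3 4 6 free_walks_start[OF 2[symmetric]] using 5 2 by auto
    next
      case 3
      have S: "H - x - y > y" using y by linarith
      \<comment> \<open>The particle has entered before. It cannot reach a height below the region or the notch
        where another particle enters.\<close>
      have 4: "up_row x y i = 0" if "y = x + 2 * int c \<or> x + y < 0"
      proof (cases "y = x + 2 * int c")
        case True
        then show ?thesis unfolding up_row_def using 3 S by (simp add: free_walks_above)
      next
        case False
        then have xy: "x + y = - 1" using that y by linarith
        then have "source i - y > 0" "source i - y > x + 2 * int c - source i" using sb y(1) by linarith+
        then have "free_walks x y i = 0" by (intro free_walks_below) simp
        moreover have "free_walks x (H - x - y) i = 0" using sb xy b_int a_pos by (intro free_walks_above) linarith
        ultimately show ?thesis by (simp add: up_row_def)
      qed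
      have 5: "(if (x, y) \<in> A then if y = x + 2 * int c then 1 / 2 else 1 else 0) * up_row x y i = up_row x y i"
      proof (cases "y = x + 2 * int c \<or> x + y < 0")
        case False
        then have "(x, y) \<in> A" unfolding in_A using y by (intro conjI; linarith)
        then show ?thesis using False by simp
      qed (simp add: 4)
      show ?thesis
      proof (cases "x + 1 + 2 * y = H")
        case True
        have out: "(x, y + 1) \<notin> A" unfolding in_A using True dist by auto
        have S': "H - x - y = y + 1" using True by linarith
        show ?thesis unfolding 5 unfolding up_row_def S' using True out by (simp add: down_row_def free_walks_Suc[OF 3])
      next
        case False
        have 6: "(if (x, y + 1) \<in> A then 1 else 0) * up_row x (y + 1) i = up_row x (y + 1) i"
        proof (cases "(x, y + 1) \<in> A")
          case N: False
          have "source i < y + 1"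
          proof (rule ccontr)
            assume "\<not> source i < y + 1"
            then have "(x, y + 1) \<in> A" unfolding in_A using y False 3 sb dist by (intro conjI; linarith)
            then show False using N by simp
          qed
          moreover have "source i < H - x - (y + 1)" using calculation y False by linarith
          ultimately have "up_row x (y + 1) i = 0" by (simp add: up_row_def free_walks_above)
          then show ?thesis by simp
        qed simp
        have 7: "H - (x + 1) - y = H - x - (y + 1)" "H - x - (y + 1) + 1 = H - x - y" by simp_all
        show ?thesis unfolding 5 6 using False unfolding down_row_def up_row_def free_walks_Suc[OF 3] 7 by simp
      qed
    qed
  qed
  then show ?thesis unfolding step_row_def E D .
qed

text \<open>
  At the lines where a particle enters there is one more triangle \<open>up\<close> than there are triangles \<open>down\<close>.
\<close>

lemma column_A_eq:
  assumes "- int c \<le> x" "x < int b"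
  shows "column x A = (if x + 2 * int c < int a + int c then insert (x + 2 * int c) (column x B) else column x B)"
proof (cases "x + 2 * int c < int a + int c")
  case True
  have "x + 2 * (x + 2 * int c) = 3 * (x + 2 * int c) - 2 * int c" by simp
  also have "\<dots> \<le> H" using True b_int by simp
  finally have "y \<in> column x A \<longleftrightarrow> y = x + 2 * int c \<or> y \<in> column x B" for y
    unfolding column_def mem_Collect_eq in_A in_B using assms True by auto
  then show ?thesis using True by auto
next
  case False
  have "y \<in> column x A \<longleftrightarrow> y \<in> column x B" for y
    unfolding column_def mem_Collect_eq in_A in_B using assms False a_pos by auto
  then show ?thesis using False by auto
qed

lemma below_source: "y \<in> column x B \<Longrightarrow> y < x + 2 * int c"
  by (simp add: column_def in_B)

text \<open>
  The starting heights of the particles that have not entered before the line \<open>x\<close>. Their rows are unit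
  vectors; with them the determinant has size \<open>a\<close> on every line.
\<close>

definition waiting :: "int \<Rightarrow> int list" where
  "waiting x = rev [x + 2 * int c..int a + int c - 1]"

lemma waiting_Suc:
  "x + 2 * int c < int a + int c \<Longrightarrow> waiting x = waiting (x + 1) @ [x + 2 * int c]"
  unfolding waiting_def by (subst upto_rec1) (auto simp: algebra_simps)

lemma waiting_empty: "x \<ge> int a - int c \<Longrightarrow> waiting x = []"
  by (simp add: waiting_def)

lemma set_waiting: "set (waiting x) = {x + 2 * int c..int a + int c - 1}"
  by (simp add: waiting_def)

lemma length_waiting: "length (waiting x) = nat (int a - int c - x)"
  by (simp add: waiting_def)

definition touch :: "int \<Rightarrow> int \<Rightarrow> real" where
  "touch x y = (if x + 2 * y = H then 2 else 1)"

lemma up_row_eq: "up_row x y = (\<lambda>i. touch x y * down_row x y i)"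
proof
  fix i
  show "up_row x y i = touch x y * down_row x y i"
  proof (cases "x + 2 * y = H")
    case True
    then have "H - x - y = y" by linarith
    then have "up_row x y i = 2 * free_walks x y i" unfolding up_row_def by (simp only: mult_2)
    then show ?thesis using True by (simp add: down_row_def touch_def)
  qed (simp add: down_row_def touch_def)
qed

lemma row_det_up_row:
  "row_det (us @ map (up_row x) zs) = (\<Prod>z\<leftarrow>zs. touch x z) * row_det (us @ map (down_row x) zs)"
proof (induction zs arbitrary: us)
  case (Cons z zs)
  have "row_det (us @ map (up_row x) (z # zs)) = touch x z * row_det (us @ down_row x z # map (up_row x) zs)"
    using row_det_linear[of us "touch x z" "down_row x z" 0 "down_row x z" "map (up_row x) zs"]
    by (simp add: up_row_eq[of x z])
  also have "row_det (us @ down_row x z # map (up_row x) zs) =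
      (\<Prod>z\<leftarrow>zs. touch x z) * row_det (us @ map (down_row x) (z # zs))"
    using Cons.IH[of "us @ [down_row x z]"] by simp
  finally show ?case by simp
qed simp

lemma weight_across:
  assumes "(x, y) \<in> A"
  shows "w {up (x, y), down (x, y)} = 1 / touch x y"
  using Ha_weights(3)[OF a_pos c_pos b_large assms] by (simp add: touch_def)

text \<open>
  The product of the weights of the lozenges across the lines to the left of \<open>x\<close>, as if there were no
  particles. A particle then contributes the inverse of the weight of the lozenge it replaces,
  which is \<open>touch\<close>. The notches where particles enter lie below the wall and contribute \<open>1\<close>.
\<close>

definition gauge :: "int \<Rightarrow> real" where
  "gauge x = (\<Prod>(x', y)\<in>left_of x A. 1 / touch x' y)"

lemma gauge_Suc: "gauge (x + 1) = gauge x * (\<Prod>y\<in>column x A. 1 / touch x y)"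
proof -
  have "gauge (x + 1) = gauge x * (\<Prod>p\<in>Pair x ` column x A. case p of (x', y) \<Rightarrow> 1 / touch x' y)"
    unfolding gauge_def left_of_Suc
    by (rule prod.union_disjoint) (auto simp: left_of_def)
  also have "(\<Prod>p\<in>Pair x ` column x A. case p of (x', y) \<Rightarrow> 1 / touch x' y) = (\<Prod>y\<in>column x A. 1 / touch x y)"
    by (subst prod.reindex) (auto simp: inj_on_def)
  finally show ?thesis .
qed

text \<open>
  After all triangles on the right of the strip have been matched, the triangles \<open>up\<close> without a particle
  are matched across the line \<open>x\<close>. If a source lies on this line, it has no partner there and must
  carry a particle; otherwise there is no tiling, and the column of that source vanishes in the
  determinant.
\<close>

lemma strip_base:
  assumes x: "- int c \<le> x" "x < int b"
    and IH: "\<And>ys. sorted_wrt (>) ys \<Longrightarrow> set ys \<subseteq> column x B \<Longrightarrow> length (waiting x) + length ys = a \<Longrightarrow>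
      left_sum w A B x (set ys) = gauge x * row_det (map (down_row x) (waiting x @ ys))"
    and zs: "sorted_wrt (>) zs" "set zs \<subseteq> column x A" "length zs = a - length (waiting (x + 1))"
  shows "strip_sum w A B x (column x A - set zs) (column x B) {} =
    gauge (x + 1) * row_det (map (up_row x) (waiting (x + 1)) @ map (up_row x) zs)"
proof -
  let ?P = "column x A" and ?R = "column x B" and ?s = "x + 2 * int c"
  have fin: "finite ?P" "finite ?R" by simp_all
  have len: "length (waiting (x + 1)) + length zs = a"
    using zs(3) x by (simp add: length_waiting)
  have T: "(\<Prod>y\<in>set zs. touch x y) = (\<Prod>z\<leftarrow>zs. touch x z)"
    by (rule prod.distinct_set_conv_list) (rule distinct_if_decreasing[OF zs(1)])
  \<comment> \<open>A waiting particle is below the wall, so its row carries no factor.\<close>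
  have one: "touch x s = 1" if "s \<in> set (waiting x)" for s
  proof -
    have "x + 2 * s < H" using that b_int unfolding set_waiting by auto
    then show ?thesis by (simp add: touch_def)
  qed
  have across: "(\<Prod>y\<in>?P - set zs. w {up (x, y), down (x, y)}) = (\<Prod>y\<in>?P. 1 / touch x y) * (\<Prod>z\<leftarrow>zs. touch x z)"
  proof -
    have "(\<Prod>y\<in>?P. 1 / touch x y) = (\<Prod>y\<in>?P - set zs. 1 / touch x y) * (\<Prod>y\<in>set zs. 1 / touch x y)"
      using prod.subset_diff[OF zs(2) fin(1)] .
    moreover have "(\<Prod>y\<in>set zs. 1 / touch x y) * (\<Prod>y\<in>set zs. touch x y) = 1"
      unfolding prod.distrib[symmetric] by (rule prod.neutral) (simp add: touch_def)
    moreover have "(\<Prod>y\<in>?P - set zs. w {up (x, y), down (x, y)}) = (\<Prod>y\<in>?P - set zs. 1 / touch x y)"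
      by (rule prod.cong) (auto simp: weight_across column_def)
    ultimately show ?thesis by (simp add: T[symmetric])
  qed
  have rows: "row_det (map (up_row x) (waiting (x + 1)) @ map (up_row x) zs) =
      (\<Prod>z\<leftarrow>zs. touch x z) * row_det (map (down_row x) (waiting (x + 1) @ zs))"
  proof -
    have "set (waiting (x + 1)) \<subseteq> set (waiting x)" unfolding set_waiting by auto
    then have eq: "map (up_row x) (waiting (x + 1)) = map (down_row x) (waiting (x + 1))"
      using one by (auto simp: up_row_eq)
    show ?thesis unfolding row_det_up_row map_append eq ..
  qed
  show ?thesis
  proof (cases "?s < int a + int c \<and> ?s \<notin> set zs")
    case True
    then have P: "?P = insert ?s ?R" using column_A_eq[OF x] by simp
    have "?s \<notin> ?R" using below_source by blast
    then have "strip_sum w A B x (?P - set zs) ?R {} = 0"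
      using strip_sum_left[of A B "?P - set zs" ?R w x] fin P True by auto
    moreover
    have "row_det (map (up_row x) (waiting (x + 1) @ zs)) = 0"
    proof (rule row_det_eq_0_if_zero_column)
      let ?i = "nat (int a - int c - 1 - x)"
      have i: "?i < a" "source ?i = ?s" using True x by (auto simp: source_def)
      show "?i < length (map (up_row x) (waiting (x + 1) @ zs))" using i(1) len by simp
      fix v assume "v \<in> set (map (up_row x) (waiting (x + 1) @ zs))"
      then obtain s where s: "v = up_row x s" "s \<in> set (waiting (x + 1)) \<or> s \<in> set zs" by auto
      have "s \<noteq> ?s" using s(2) True unfolding set_waiting by auto
      moreover have "x + 2 * s \<le> H"
        using s(2)
      proof
        assume "s \<in> set (waiting (x + 1))"
        then show ?thesis unfolding set_waiting using b_int by auto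
      next
        assume "s \<in> set zs"
        then show ?thesis using zs(2) by (auto simp: column_def in_A)
      qed
      ultimately show "v ?i = 0" using up_row_waiting[of ?i x s] i s(1) by simp
    qed
    ultimately show ?thesis by simp
  next
    case False
    obtain ys where ys: "waiting (x + 1) @ zs = waiting x @ ys" "sorted_wrt (>) ys" "set ys \<subseteq> ?R"
      "?P - set zs \<subseteq> ?R" "?R - (?P - set zs) = set ys"
    proof (cases "?s < int a + int c")
      case start: True
      then have P: "?P = insert ?s ?R" using column_A_eq[OF x] by simp
      have s: "?s \<in> set zs" using False start by simp
      then obtain z ys where z: "zs = z # ys" by (cases zs) auto
      have "z = ?s"
      proof (rule ccontr)
        assume "z \<noteq> ?s"
        then have "z > ?s" using s z zs(1) by auto
        moreover have "z \<in> ?P" using zs(2) z by simp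
        ultimately show False using P below_source[of z x] by auto
      qed
      then have ns: "?s \<notin> set ys" "?s \<notin> ?R" using z zs(1) below_source[of ?s x] by auto
      show ?thesis
      proof (rule that)
        show "waiting (x + 1) @ zs = waiting x @ ys" using waiting_Suc[OF start] z \<open>z = ?s\<close> by simp
        show "sorted_wrt (>) ys" using zs(1) z by simp
        show "set ys \<subseteq> ?R" using zs(2) z P ns by auto
        then show "?R - (?P - set zs) = set ys" using P z \<open>z = ?s\<close> ns by auto
        show "?P - set zs \<subseteq> ?R" using P s by auto
      qed
    next
      case start: False
      then have P: "?P = ?R" using column_A_eq[OF x] by simp
      have "waiting x = []" "waiting (x + 1) = []" using start by (simp_all add: waiting_empty)
      then show ?thesis using that[of zs] zs P by (auto simp: double_diff)
    qed
    have "strip_sum w A B x (?P - set zs) ?R {} =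
        (\<Prod>y\<in>?P - set zs. w {up (x, y), down (x, y)}) * left_sum w A B x (set ys)"
      using strip_sum_left[of A B "?P - set zs" ?R w x] fin ys(4,5) by simp
    also have "left_sum w A B x (set ys) = gauge x * row_det (map (down_row x) (waiting x @ ys))"
      using len arg_cong[OF ys(1), of length] by (intro IH[OF ys(2,3)]) simp
    finally show ?thesis unfolding across gauge_Suc rows ys(1) by simp
  qed
qed

text \<open>
  At the leftmost line nothing has been tiled and all particles are waiting, so that the matrix is
  the identity. Each strip is then crossed by \<open>strip_transfer\<close>.
\<close>

lemma left_sum_eq_row_det:
  assumes "n \<le> b + c"
    and "sorted_wrt (>) ys" "set ys \<subseteq> column (int n - int c) B" "length (waiting (int n - int c)) + length ys = a"
  shows "left_sum w A B (int n - int c) (set ys) =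
    gauge (int n - int c) * row_det (map (down_row (int n - int c)) (waiting (int n - int c) @ ys))"
  using assms
proof (induction n arbitrary: ys)
  case 0
  have "column (- int c) B = {}" "left_of (- int c) A = {}" "left_of (- int c) B = {}"
    by (auto simp: column_def left_of_def Ha_down_def Ha_up_def)
  then have "ys = []" "left_sum w A B (- int c) {} = 1" "gauge (- int c) = 1"
    using 0 by (simp_all add: left_sum_def region_sum_def gauge_def)
  moreover have "row_det (map (down_row (- int c)) (waiting (- int c))) = 1"
  proof -
    have len: "length (waiting (- int c)) = a" by (simp add: length_waiting)
    have nth: "waiting (- int c) ! i = source i" if "i < a" for i
      using that by (simp add: waiting_def rev_nth source_def nth_upto)
    have ent: "down_row (- int c) (source i) j = (if i = j then 1 else 0)" if "i < a" "j < a" for i j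
    proof -
      have low: "- int c + 2 * source i < H" using that wait_below_wall[of i "- int c"] source_bounds(1)[of i] by simp
      then have "down_row (- int c) (source i) j = up_row (- int c) (source i) j" by (simp add: down_row_def)
      also have "\<dots> = (if source i = source j then 1 else 0)"
        using that low source_bounds(1)[of j] by (intro up_row_waiting) auto
      also have "source i = source j \<longleftrightarrow> i = j" by (simp add: source_def)
      finally show ?thesis .
    qed
    have "row_det (map (down_row (- int c)) (waiting (- int c))) = (\<Prod>i<a. 1)"
      unfolding row_det_def length_map len
      by (subst fdet_upper_triangular) (auto simp: len nth ent)
    then show ?thesis by simp
  qed
  ultimately show ?case by simp
next
  case (Suc n)
  define x where "x = int n - int c"
  have x1: "int (Suc n) - int c = x + 1" by (simp add: x_def)
  have x: "- int c \<le> x" "x < int b" using Suc.prems(1) by (auto simp: x_def)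
  have IH: "left_sum w A B x (set ys) = gauge x * row_det (map (down_row x) (waiting x @ ys))"
    if "sorted_wrt (>) ys" "set ys \<subseteq> column x B" "length (waiting x) + length ys = a" for ys
    using Suc.IH[of ys] Suc.prems(1) that by (simp add: x_def)
  note prems = Suc.prems(2-)[unfolded x1]
  have "left_sum w A B (x + 1) (set ys) = strip_sum w A B x (column x A - set []) (column x B) (set ys)"
    by (simp add: left_sum_Suc)
  also have "\<dots> = gauge (x + 1) * row_det (map (up_row x) (waiting (x + 1)) @ map (up_row x) [] @
      map (step_row w x (column x A) (up_row x)) ys)"
  proof (rule strip_transfer[where n = "length ys"])
    fix zs assume "sorted_wrt (>) zs" "set zs \<subseteq> column x A" "length zs = length ys"
    then show "strip_sum w A B x (column x A - set zs) (column x B) {} =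
        gauge (x + 1) * row_det (map (up_row x) (waiting (x + 1)) @ map (up_row x) zs)"
      using prems(3) by (intro strip_base[OF x IH]) auto
  qed (use prems in auto)
  also have "row_det (map (up_row x) (waiting (x + 1)) @ map (up_row x) [] @ map (step_row w x (column x A) (up_row x)) ys)
      = row_det (map (down_row (x + 1)) (waiting (x + 1) @ ys))"
  proof (rule row_det_cong)
    show "list_all2 (\<lambda>u v. \<forall>i<length (waiting (x + 1) @ ys). u i = v i)
      (map (up_row x) (waiting (x + 1)) @ map (up_row x) [] @ map (step_row w x (column x A) (up_row x)) ys)
      (map (down_row (x + 1)) (waiting (x + 1) @ ys))"
    proof -
      have "up_row x s i = down_row (x + 1) s i" if "s \<in> set (waiting (x + 1))" "i < a" for s i
        using that(1) unfolding set_waiting by (intro waiting_row[OF that(2)]) auto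
      moreover have "step_row w x (column x A) (up_row x) y i = down_row (x + 1) y i" if "y \<in> set ys" "i < a" for y i
        using that step_row_eq[of x y i] prems(2) by (auto simp: column_def)
      ultimately show ?thesis using prems(3)
        by (auto simp: list.rel_map intro!: list_all2_appendI list.rel_refl_strong)
    qed
  qed simp
  finally show ?case unfolding x1 .
qed

lemma column_right: "column (int b) B = {0..<int a}"
  unfolding column_def in_B using b_int c_pos by auto

lemma gauge_right: "gauge (int b) = (1 / 2) ^ c"
proof -
  let ?wall = "{p \<in> A. fst p + 2 * snd p = H}"
  have wall: "?wall = (\<lambda>j. (int b - 2 * int c + 1 + 2 * int j, int a + int c - 1 - int j)) ` {..<c}"
  proof (intro equalityI subsetI)
    fix p assume "p \<in> ?wall"
    then obtain x y where p: "p = (x, y)" "(x, y) \<in> A" "x + 2 * y = H" by (cases p) auto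
    then have xy: "x < int b" "y < int a + int c" by (auto simp: in_A)
    then have "int a \<le> y" using p(3) by linarith
    then have "nat (int a + int c - 1 - y) < c"
      "x = int b - 2 * int c + 1 + 2 * int (nat (int a + int c - 1 - y))"
      "y = int a + int c - 1 - int (nat (int a + int c - 1 - y))"
      using xy p(3) by auto
    then show "p \<in> (\<lambda>j. (int b - 2 * int c + 1 + 2 * int j, int a + int c - 1 - int j)) ` {..<c}"
      unfolding p(1) by blast
  next
    fix p assume "p \<in> (\<lambda>j. (int b - 2 * int c + 1 + 2 * int j, int a + int c - 1 - int j)) ` {..<c}"
    then obtain j where "j < c" "p = (int b - 2 * int c + 1 + 2 * int j, int a + int c - 1 - int j)" by auto
    then show "p \<in> ?wall" using b_int a_pos by (simp add: in_A)
  qed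
  have "gauge (int b) = (\<Prod>p\<in>A. if fst p + 2 * snd p = H then 1 / 2 else 1)"
    unfolding gauge_def by (rule prod.cong) (auto simp: left_of_def touch_def in_A)
  also have "\<dots> = (1 / 2) ^ card ?wall"
    by (simp add: prod.If_cases Int_def)
  also have "card ?wall = c"
    unfolding wall by (subst card_image) (auto simp: inj_on_def)
  finally show ?thesis .
qed

text \<open>
  The southeastern side is the line \<open>x = b\<close>; for reasons of parity it carries no point of the wall.
\<close>

lemma count_eq_row_det:
  "region_sum w A B = (1 / 2) ^ c * row_det (map (up_row (int b)) (rev [0..int a - 1]))"
proof -
  have b: "int (b + c) - int c = int b" by simp
  have dec: "sorted_wrt (>) (rev [0..int a - 1])"
    by (simp add: sorted_wrt_rev)
  have wait: "waiting (int b) = []" using b_int c_pos by (simp add: waiting_empty)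
  have set: "set (rev [0..int a - 1]) = column (int b) B" by (auto simp: column_right)
  have "left_of (int b) A = A" "left_of (int b) B \<union> Pair (int b) ` column (int b) B = B"
    by (auto simp: left_of_def column_def in_A in_B)
  then have "region_sum w A B = left_sum w A B (int b) (column (int b) B)" by (simp add: left_sum_def)
  also have "\<dots> = gauge (int b) * row_det (map (down_row (int b)) (rev [0..int a - 1]))"
    using left_sum_eq_row_det[of "b + c" "rev [0..int a - 1]", unfolded b set wait] dec by simp
  also have "down_row (int b) = up_row (int b)"
  proof (intro ext)
    fix s i
    have "int b + 2 * s \<noteq> H" by presburger
    then show "down_row (int b) s i = up_row (int b) s i" by (simp add: down_row_def)
  qed
  finally show ?thesis by (simp add: gauge_right)
qed

text \<open>
  The matrix \<open>?Q\<close> is lower unitriangular, so multiplying by it does not change the determinant; its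
  \<open>m\<close>-th row lets the walks continue for \<open>2 m + 1\<close> steps up to the wall.
\<close>

lemma row_det_right_boundary:
  "row_det (map (up_row (int b)) (rev [0..int a - 1])) =
    (\<Prod>m<a. real (b - a + 2 * c + 3 * m + 2) / 2) * fdet a (wall_entry (b - a) c)"
proof -
  define B' where "B' = b - a"
  have bB: "b = B' + a" using b_large c_pos by (simp add: B'_def)
  let ?N = "\<lambda>i. B' + c + 1 + i" and ?d = "\<lambda>i. int c - int i"
  let ?M = "\<lambda>k i. half_walks (?N i) (?d i + int k) + half_walks (?N i) (?d i - 1 - int k)"
  let ?Q = "\<lambda>m k. if k \<le> m then real (2 * m + 1 choose (m - k)) else 0"
  let ?v = "\<lambda>m. real (B' + 2 * c + 3 * m + 2) / 2"
  have len: "length (rev [0..int a - 1]) = a" by simp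
  have "row_det (map (up_row (int b)) (rev [0..int a - 1])) = fdet a ?M"
    unfolding row_det_def length_map len
  proof (rule fdet_cong)
    fix k i assume k: "k < a" and i: "i < a"
    have s: "map (up_row (int b)) (rev [0..int a - 1]) ! k = up_row (int b) (int a - 1 - int k)"
      using k by (simp add: rev_nth of_nat_diff algebra_simps)
    have n: "nat (int b + 2 * int c - source i) = ?N i"
      "source i - (int a - 1 - int k) = ?d i + int k"
      "source i - (H - int b - (int a - 1 - int k)) = ?d i - 1 - int k"
      using i unfolding source_def bB by auto
    show "(map (up_row (int b)) (rev [0..int a - 1]) ! k) i = ?M k i"
      unfolding s up_row_def free_walks_def n ..
  qed
  also have "\<dots> = fdet a ?Q * fdet a ?M"
    by (subst fdet_lower_triangular) auto
  also have "\<dots> = fdet a (\<lambda>m i. ?v m * wall_entry B' c i m)"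
    unfolding fdet_mult
  proof (rule fdet_cong)
    fix m i assume "m < a"
    then show "(\<Sum>k<a. ?Q m k * ?M k i) = ?v m * wall_entry B' c i m"
      using half_walks_fold[of "?N i" m a "?d i"] half_walks_wall_entry[of B' c i m] by simp
  qed
  also have "\<dots> = (\<Prod>m<a. ?v m) * fdet a (wall_entry B' c)"
    unfolding fdet_scale_rows fdet_transpose[of a "wall_entry B' c"] ..
  finally show ?thesis by (simp add: B'_def)
qed

end

theorem theorem1p7:
  fixes a b c :: nat
  assumes "a > 0" and "b > 0" and "c > 0"
    and "b \<ge> a + c - 1"
  shows "weighted_count_Ha a b c =
    (1/2) ^ (c + a) *
    (pochhammer (real b + 2 * real c - real a + 2) a / pochhammer (real a + real b - real c + 2) a) *
    (\<Prod>j = 1..a.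
       (fact (j - 1) * fact (b + c - a + 2 * j - 1)
         * pochhammer (real b - real a - real c + 2 * real j + 2) j
         * pochhammer (real b + 2 * real c - real a + 3 * real j + 2) (a - j))
       / (fact (b + 2 * j - 1) * fact (c + a - j)))"
proof -
  interpret trimmed_hexagon a b c by standard (use assms in auto)
  have c: "c \<le> b - a + 1" and b: "b = b - a + a" using assms by auto
  have "weighted_count_Ha a b c =
      (1 / 2) ^ c * ((\<Prod>m<a. real (b - a + 2 * c + 3 * m + 2) / 2) * wall_product a (b - a) c)"
    unfolding weighted_count_Ha_eq[OF assms(1,3,4)] count_eq_row_det row_det_right_boundary fdet_wall_entry[OF c] ..
  also note wall_product_formula[OF c b]
  finally show ?thesis .
qed

end
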